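(* Let $W$ be a Coxeter group with generating set $S$ and let $w\in W$ with $w\neq 1$. Then $$C(w)=\sum_{\substack{\emptyset\neq T\subseteq D(w)\\ T\text{ independent}}}(-1)^{|T|+1}\,C(Tw).$$
   Context: A Coxeter group generated by $S$ is given by a Coxeter graph on $S$ (edges labeled $\infty$ or an integer $\ge3$): relations $aa=1$ for all $a\in S$, $ab=ba$ when $a,b$ are non-adjacent, and $aba\cdots=bab\cdots$ (alternating words of length $m$) when the edge $\{a,b\}$ has label $m<\infty$. A word is reduced if no equivalent word is shorter; $\ell(w)$ is the length of any reduced word for $w$. Two reduced words for $w$ are in the same commutation class if one can be obtained from the other by repeatedly swapping adjacent letters $ab\to ba$ with $a\ne b$ commuting (non-adjacent in the Coxeter graph). $C(w)$ is the number of commutation classes of reduced words for $w$. The left descent set is $D(w)=\{a\in S:\ell(aw)<\ell(w)\}$. A subset $T\subseteq S$ is independent if all its elements pairwise commute (an independent set in the Coxeter graph), and then $T$ also denotes the product of its elements in $W$ (well-defined since they commute). *)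

theory Defs
  imports "HOL-Algebra.Group" "HOL-Library.Extended_Nat"
begin

section \<open>Coxeter graphs and Coxeter groups\<close>

text \<open>The label of an edge is an extended natural number, so that the label \<open>\<infinity>\<close> is allowed.
  The generating set may be infinite. Labels of sets that are not edges are irrelevant.\<close>

record 'a coxeter_graph =
  gens :: "'a set"
  edges :: "'a set set"
  label :: "'a set \<Rightarrow> enat"

definition is_coxeter_graph :: "'a coxeter_graph \<Rightarrow> bool" where
  "is_coxeter_graph \<Gamma> \<longleftrightarrow>
     (\<forall>e\<in>edges \<Gamma>. e \<subseteq> gens \<Gamma> \<and> card e = 2 \<and> label \<Gamma> e \<ge> 3)"

definition adjacent :: "'a coxeter_graph \<Rightarrow> 'a \<Rightarrow> 'a \<Rightarrow> bool" where
  "adjacent \<Gamma> a b \<longleftrightarrow> {a, b} \<in> edges \<Gamma>"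

fun alternating :: "nat \<Rightarrow> 'a \<Rightarrow> 'a \<Rightarrow> 'a list" where
  "alternating 0 a b = []"
| "alternating (Suc n) a b = a # alternating n b a"

inductive coxeter_relation :: "'a coxeter_graph \<Rightarrow> 'a list \<Rightarrow> 'a list \<Rightarrow> bool" for \<Gamma> where
  involution: "a \<in> gens \<Gamma> \<Longrightarrow> coxeter_relation \<Gamma> [a, a] []"
| commutation: "a \<in> gens \<Gamma> \<Longrightarrow> b \<in> gens \<Gamma> \<Longrightarrow> a \<noteq> b \<Longrightarrow> \<not> adjacent \<Gamma> a b \<Longrightarrow>
    coxeter_relation \<Gamma> [a, b] [b, a]"
| braid: "a \<in> gens \<Gamma> \<Longrightarrow> b \<in> gens \<Gamma> \<Longrightarrow> adjacent \<Gamma> a b \<Longrightarrow> label \<Gamma> {a, b} = enat k \<Longrightarrow>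
    coxeter_relation \<Gamma> (alternating k a b) (alternating k b a)"

inductive word_equiv :: "'a coxeter_graph \<Rightarrow> 'a list \<Rightarrow> 'a list \<Rightarrow> bool" for \<Gamma> where
  relation: "coxeter_relation \<Gamma> u v \<Longrightarrow> x \<in> lists (gens \<Gamma>) \<Longrightarrow> y \<in> lists (gens \<Gamma>) \<Longrightarrow>
    word_equiv \<Gamma> (x @ u @ y) (x @ v @ y)"
| refl: "u \<in> lists (gens \<Gamma>) \<Longrightarrow> word_equiv \<Gamma> u u"
| sym: "word_equiv \<Gamma> u v \<Longrightarrow> word_equiv \<Gamma> v u"
| trans: "word_equiv \<Gamma> u v \<Longrightarrow> word_equiv \<Gamma> v t \<Longrightarrow> word_equiv \<Gamma> u t"

definition word_rel :: "'a coxeter_graph \<Rightarrow> ('a list \<times> 'a list) set" where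
  "word_rel \<Gamma> = {(u, v). word_equiv \<Gamma> u v}"

definition word_class :: "'a coxeter_graph \<Rightarrow> 'a list \<Rightarrow> 'a list set" where
  "word_class \<Gamma> u = word_rel \<Gamma> `` {u}"

text \<open>Every generator is an involution, so the group with the given presentation is the monoid
  with the same presentation: words in the generators modulo the generated congruence. An element
  of the group is thus the set of all words representing it.\<close>

definition coxeter_group :: "'a coxeter_graph \<Rightarrow> 'a list set monoid" where
  "coxeter_group \<Gamma> =
     \<lparr>carrier = lists (gens \<Gamma>) // word_rel \<Gamma>,
      mult = (\<lambda>x y. \<Union>u\<in>x. \<Union>v\<in>y. word_class \<Gamma> (u @ v)),
      one = word_class \<Gamma> []\<rparr>"


section \<open>Reduced words, commutation classes, descents\<close>

definition reduced :: "'a coxeter_graph \<Rightarrow> 'a list \<Rightarrow> bool" where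
  "reduced \<Gamma> u \<longleftrightarrow> u \<in> lists (gens \<Gamma>) \<and> (\<forall>v. word_equiv \<Gamma> u v \<longrightarrow> length u \<le> length v)"

definition reduced_words :: "'a coxeter_graph \<Rightarrow> 'a list set \<Rightarrow> 'a list set" where
  "reduced_words \<Gamma> w = {u \<in> w. reduced \<Gamma> u}"

definition cox_length :: "'a coxeter_graph \<Rightarrow> 'a list set \<Rightarrow> nat" where
  "cox_length \<Gamma> w = (THE n. \<exists>u\<in>reduced_words \<Gamma> w. length u = n)"

definition commutation_move :: "'a coxeter_graph \<Rightarrow> ('a list \<times> 'a list) set" where
  "commutation_move \<Gamma> = {(x @ [a, b] @ y, x @ [b, a] @ y) | x a b y.
     a \<in> gens \<Gamma> \<and> b \<in> gens \<Gamma> \<and> a \<noteq> b \<and> \<not> adjacent \<Gamma> a b}"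

definition commutation_classes :: "'a coxeter_graph \<Rightarrow> 'a list set \<Rightarrow> 'a list set set" where
  "commutation_classes \<Gamma> w =
     reduced_words \<Gamma> w //
       ((commutation_move \<Gamma>)\<^sup>* \<inter> reduced_words \<Gamma> w \<times> reduced_words \<Gamma> w)"

definition num_commutation_classes :: "'a coxeter_graph \<Rightarrow> 'a list set \<Rightarrow> nat" where
  "num_commutation_classes \<Gamma> w = card (commutation_classes \<Gamma> w)"

definition left_descents :: "'a coxeter_graph \<Rightarrow> 'a list set \<Rightarrow> 'a set" where
  "left_descents \<Gamma> w =
     {a \<in> gens \<Gamma>. cox_length \<Gamma> (word_class \<Gamma> [a] \<otimes>\<^bsub>coxeter_group \<Gamma>\<^esub> w) < cox_length \<Gamma> w}"

definition independent_set :: "'a coxeter_graph \<Rightarrow> 'a set \<Rightarrow> bool" where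
  "independent_set \<Gamma> T \<longleftrightarrow> T \<subseteq> gens \<Gamma> \<and> (\<forall>a\<in>T. \<forall>b\<in>T. a \<noteq> b \<longrightarrow> \<not> adjacent \<Gamma> a b)"

text \<open>The product of a finite independent set of generators; it does not depend on the chosen
  enumeration, see \<open>set_product_eq\<close> below.\<close>

definition set_product :: "'a coxeter_graph \<Rightarrow> 'a set \<Rightarrow> 'a list set" where
  "set_product \<Gamma> T = word_class \<Gamma> (SOME xs. distinct xs \<and> set xs = T)"


section \<open>Well-definedness\<close>

lemma coxeter_relation_lists:
  assumes "coxeter_relation \<Gamma> u v"
  shows "u \<in> lists (gens \<Gamma>) \<and> v \<in> lists (gens \<Gamma>)"
proof -
  have alt: "alternating k a b \<in> lists (gens \<Gamma>)"
    if "a \<in> gens \<Gamma>" "b \<in> gens \<Gamma>" for k a b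
    using that by (induction k arbitrary: a b) auto
  show ?thesis
    using assms by cases (auto simp: alt simp flip: in_lists_conv_set)
qed

lemma word_equiv_lists:
  "word_equiv \<Gamma> u v \<Longrightarrow> u \<in> lists (gens \<Gamma>) \<and> v \<in> lists (gens \<Gamma>)"
proof (induction rule: word_equiv.induct)
  case (relation u v x y)
  then show ?case using coxeter_relation_lists[of \<Gamma> u v] by auto
qed simp_all

lemma equiv_word_rel: "equiv (lists (gens \<Gamma>)) (word_rel \<Gamma>)"
proof (rule equivI)
  show "word_rel \<Gamma> \<subseteq> lists (gens \<Gamma>) \<times> lists (gens \<Gamma>)"
    unfolding word_rel_def using word_equiv_lists by blast
  show "refl_on (lists (gens \<Gamma>)) (word_rel \<Gamma>)"
    by (rule refl_onI) (simp add: word_rel_def word_equiv.refl del: in_lists_conv_set)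
  show "sym (word_rel \<Gamma>)"
    by (rule symI) (simp add: word_rel_def word_equiv.sym)
  show "trans (word_rel \<Gamma>)"
    by (rule transI) (unfold word_rel_def mem_Collect_eq prod.case, rule word_equiv.trans)
qed

lemma word_equiv_context:
  assumes "word_equiv \<Gamma> u v" "x \<in> lists (gens \<Gamma>)" "y \<in> lists (gens \<Gamma>)"
  shows "word_equiv \<Gamma> (x @ u @ y) (x @ v @ y)"
  using assms
proof (induction rule: word_equiv.induct)
  case (relation u v x' y')
  then show ?case
    using word_equiv.relation[of \<Gamma> u v "x @ x'" "y' @ y"] by simp
next
  case (refl u)
  then show ?case by (intro word_equiv.refl) auto
qed (blast intro: word_equiv.sym word_equiv.trans)+

lemma word_equiv_append:
  assumes "word_equiv \<Gamma> u u'" "word_equiv \<Gamma> v v'"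
  shows "word_equiv \<Gamma> (u @ v) (u' @ v')"
proof -
  have "word_equiv \<Gamma> (u @ v) (u' @ v)"
    using word_equiv_context[of \<Gamma> u u' "[]" v] assms word_equiv_lists[of \<Gamma> v v'] by simp
  moreover have "word_equiv \<Gamma> (u' @ v) (u' @ v')"
    using word_equiv_context[of \<Gamma> v v' "u'" "[]"] assms word_equiv_lists[of \<Gamma> u u'] by simp
  ultimately show ?thesis by (rule word_equiv.trans)
qed

lemma mem_word_class [simp]: "v \<in> word_class \<Gamma> u \<longleftrightarrow> word_equiv \<Gamma> u v"
  by (simp add: word_class_def word_rel_def)

lemma word_class_eqI: "word_equiv \<Gamma> u v \<Longrightarrow> word_class \<Gamma> u = word_class \<Gamma> v"
  unfolding set_eq_iff mem_word_class by (meson word_equiv.trans word_equiv.sym)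

lemma carrier_coxeter_group:
  "carrier (coxeter_group \<Gamma>) = word_class \<Gamma> ` lists (gens \<Gamma>)"
  by (auto simp: coxeter_group_def quotient_def word_class_def)

lemma one_coxeter_group: "\<one>\<^bsub>coxeter_group \<Gamma>\<^esub> = word_class \<Gamma> []"
  by (simp add: coxeter_group_def)

lemma mult_coxeter_group:
  assumes "u \<in> lists (gens \<Gamma>)" "v \<in> lists (gens \<Gamma>)"
  shows "word_class \<Gamma> u \<otimes>\<^bsub>coxeter_group \<Gamma>\<^esub> word_class \<Gamma> v = word_class \<Gamma> (u @ v)"
proof -
  have "word_class \<Gamma> (u' @ v') = word_class \<Gamma> (u @ v)"
    if "word_equiv \<Gamma> u u'" "word_equiv \<Gamma> v v'" for u' v'
    using word_class_eqI[OF word_equiv_append[OF that]] by simp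
  moreover have "word_equiv \<Gamma> u u" "word_equiv \<Gamma> v v"
    using assms by (simp_all add: word_equiv.refl del: in_lists_conv_set)
  ultimately have "(\<Union>u'\<in>word_class \<Gamma> u. \<Union>v'\<in>word_class \<Gamma> v. word_class \<Gamma> (u' @ v'))
      = word_class \<Gamma> (u @ v)"
    unfolding mem_word_class[symmetric] by blast
  then show ?thesis by (simp add: coxeter_group_def)
qed

lemma word_equiv_rev_cancel:
  "u \<in> lists (gens \<Gamma>) \<Longrightarrow> word_equiv \<Gamma> (rev u @ u) []"
proof (induction u)
  case Nil
  then show ?case by (auto intro: word_equiv.refl)
next
  case (Cons a u)
  then have "word_equiv \<Gamma> (rev u @ [a, a] @ u) (rev u @ [] @ u)"
    by (intro word_equiv.relation coxeter_relation.involution) auto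
  then show ?case using Cons by (auto intro: word_equiv.trans)
qed

lemma group_coxeter_group: "group (coxeter_group \<Gamma>)"
proof (rule groupI)
  let ?G = "coxeter_group \<Gamma>" and ?L = "lists (gens \<Gamma>)"
  have elim: "\<exists>u\<in>?L. x = word_class \<Gamma> u" if "x \<in> carrier ?G" for x
    using that unfolding carrier_coxeter_group by blast
  have intro: "word_class \<Gamma> u \<in> carrier ?G" if "u \<in> ?L" for u
    using that unfolding carrier_coxeter_group by blast
  have app: "u @ v \<in> ?L" if "u \<in> ?L" "v \<in> ?L" for u v
    using that by simp
  have nil: "[] \<in> ?L" by simp
  show "\<one>\<^bsub>?G\<^esub> \<in> carrier ?G"
    unfolding one_coxeter_group by (rule intro) simp
  fix x assume "x \<in> carrier ?G"
  then obtain u where u: "u \<in> ?L" "x = word_class \<Gamma> u" using elim by blast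
  show "\<one>\<^bsub>?G\<^esub> \<otimes>\<^bsub>?G\<^esub> x = x"
    using mult_coxeter_group[OF nil u(1)] u(2) by (simp add: one_coxeter_group)
  have ru: "rev u \<in> ?L" using u(1) by auto
  have "word_class \<Gamma> (rev u) \<otimes>\<^bsub>?G\<^esub> x = \<one>\<^bsub>?G\<^esub>"
    using word_class_eqI[OF word_equiv_rev_cancel[OF u(1)]] mult_coxeter_group[OF ru u(1)]
    by (simp only: one_coxeter_group u(2))
  with intro[OF ru] show "\<exists>y\<in>carrier ?G. y \<otimes>\<^bsub>?G\<^esub> x = \<one>\<^bsub>?G\<^esub>" by blast
  fix y assume "y \<in> carrier ?G"
  then obtain v where v: "v \<in> ?L" "y = word_class \<Gamma> v" using elim by blast
  show "x \<otimes>\<^bsub>?G\<^esub> y \<in> carrier ?G"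
    unfolding u(2) v(2) mult_coxeter_group[OF u(1) v(1)] by (rule intro[OF app[OF u(1) v(1)]])
  fix z assume "z \<in> carrier ?G"
  then obtain t where t: "t \<in> ?L" "z = word_class \<Gamma> t" using elim by blast
  show "x \<otimes>\<^bsub>?G\<^esub> y \<otimes>\<^bsub>?G\<^esub> z = x \<otimes>\<^bsub>?G\<^esub> (y \<otimes>\<^bsub>?G\<^esub> z)"
    unfolding u(2) v(2) t(2) mult_coxeter_group[OF u(1) v(1)] mult_coxeter_group[OF v(1) t(1)]
      mult_coxeter_group[OF app[OF u(1) v(1)] t(1)] mult_coxeter_group[OF u(1) app[OF v(1) t(1)]]
    by simp
qed

lemma cox_length_eq:
  assumes w: "w \<in> carrier (coxeter_group \<Gamma>)" and u: "u \<in> reduced_words \<Gamma> w"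
  shows "cox_length \<Gamma> w = length u"
proof -
  have "length v = length u" if v: "v \<in> reduced_words \<Gamma> w" for v
  proof -
    obtain t where "w = word_class \<Gamma> t" using w by (auto simp: carrier_coxeter_group)
    then have tu: "word_equiv \<Gamma> t u" and tv: "word_equiv \<Gamma> t v"
      using u v by (auto simp: reduced_words_def)
    have "word_equiv \<Gamma> u v" "word_equiv \<Gamma> v u"
      using word_equiv.trans[OF word_equiv.sym[OF tu] tv]
        word_equiv.trans[OF word_equiv.sym[OF tv] tu] by simp_all
    moreover have "reduced \<Gamma> u" "reduced \<Gamma> v" using u v by (simp_all add: reduced_words_def)
    ultimately show ?thesis unfolding reduced_def by (intro le_antisym) blast+
  qed
  then show ?thesis unfolding cox_length_def using u by (intro the_equality) blast+
qed

lemma reduced_words_nonempty: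
  assumes "w \<in> carrier (coxeter_group \<Gamma>)"
  shows "reduced_words \<Gamma> w \<noteq> {}"
proof -
  obtain t where t: "t \<in> lists (gens \<Gamma>)" "w = word_class \<Gamma> t"
    using assms unfolding carrier_coxeter_group by blast
  obtain u where u: "word_equiv \<Gamma> t u" "\<And>v. word_equiv \<Gamma> t v \<Longrightarrow> length u \<le> length v"
    using ex_has_least_nat[of "word_equiv \<Gamma> t" t length] word_equiv.refl[OF t(1)] by blast
  then have "u \<in> reduced_words \<Gamma> w"
    using t word_equiv_lists[OF u(1)] word_equiv.trans[OF u(1)]
    unfolding reduced_words_def reduced_def by simp
  then show ?thesis by blast
qed

lemma equiv_commutation:
  "equiv (reduced_words \<Gamma> w)
     ((commutation_move \<Gamma>)\<^sup>* \<inter> reduced_words \<Gamma> w \<times> reduced_words \<Gamma> w)"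
proof -
  have "(t, u) \<in> commutation_move \<Gamma>" if "(u, t) \<in> commutation_move \<Gamma>" for u t
  proof -
    from that obtain x a b y where xy: "u = x @ [a, b] @ y" "t = x @ [b, a] @ y"
      and ab: "b \<in> gens \<Gamma> \<and> a \<in> gens \<Gamma> \<and> b \<noteq> a \<and> \<not> adjacent \<Gamma> b a"
      unfolding commutation_move_def adjacent_def by (auto simp: insert_commute)
    then show ?thesis unfolding commutation_move_def by blast
  qed
  then have "sym (commutation_move \<Gamma>)" by (rule symI)
  then have "sym ((commutation_move \<Gamma>)\<^sup>*)" by (rule sym_rtrancl)
  then show ?thesis
    by (intro equivI) (auto simp: refl_on_def sym_def trans_def)
qed

lemma word_equiv_indep_perm:
  assumes "independent_set \<Gamma> (set xs)" "distinct xs" "distinct ys" "set xs = set ys"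
  shows "word_equiv \<Gamma> xs ys"
  using assms
proof (induction xs arbitrary: ys)
  case Nil
  then show ?case by (auto intro: word_equiv.refl)
next
  case (Cons a xs)
  then obtain ys1 ys2 where ys: "ys = ys1 @ a # ys2" by (metis list.set_intros(1) split_list)
  have gens: "a \<in> gens \<Gamma>" "set ys1 \<subseteq> gens \<Gamma>" "set ys2 \<subseteq> gens \<Gamma>"
    using Cons.prems ys by (auto simp: independent_set_def)
  have ind: "\<forall>b\<in>set ys1. a \<noteq> b \<and> \<not> adjacent \<Gamma> a b"
    using Cons.prems ys by (auto simp: independent_set_def)
  have "word_equiv \<Gamma> xs (ys1 @ ys2)"
  proof (rule Cons.IH)
    show "independent_set \<Gamma> (set xs)" using Cons.prems by (auto simp: independent_set_def)
    show "set xs = set (ys1 @ ys2)" using Cons.prems ys by auto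
  qed (use Cons.prems ys in auto)
  then have 1: "word_equiv \<Gamma> (a # xs) (a # ys1 @ ys2)"
    using word_equiv_context[of \<Gamma> xs "ys1 @ ys2" "[a]" "[]"] gens by simp
  have "word_equiv \<Gamma> (a # ys1 @ ys2) (ys1 @ a # ys2)"
    using gens ind
  proof (induction ys1)
    case Nil
    then show ?case by (auto intro!: word_equiv.refl)
  next
    case (Cons b zs)
    then have "word_equiv \<Gamma> ([] @ [a, b] @ (zs @ ys2)) ([] @ [b, a] @ (zs @ ys2))"
      by (intro word_equiv.relation coxeter_relation.commutation) auto
    moreover have "word_equiv \<Gamma> ([b] @ (a # zs @ ys2) @ []) ([b] @ (zs @ a # ys2) @ [])"
      using Cons by (intro word_equiv_context) auto
    ultimately show ?case by (auto intro: word_equiv.trans)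
  qed
  with 1 show ?case using ys by (auto intro: word_equiv.trans)
qed

lemma set_product_eq:
  assumes "independent_set \<Gamma> T" "distinct xs" "set xs = T"
  shows "set_product \<Gamma> T = word_class \<Gamma> xs"
proof -
  have "distinct (SOME xs. distinct xs \<and> set xs = T) \<and> set (SOME xs. distinct xs \<and> set xs = T) = T"
    using someI[of "\<lambda>xs. distinct xs \<and> set xs = T" xs] assms by blast
  then show ?thesis
    unfolding set_product_def using assms by (intro word_class_eqI word_equiv_indep_perm) auto
qed

end

theory Submission imports Defs Complex_Main begin

text \<open>For a commutation class \<open>c\<close> of reduced words of \<open>w\<close> let \<open>L(c)\<close> be the set of first letters of
  words in \<open>c\<close>: a nonempty independent subset of \<open>D(w)\<close>. For independent \<open>T \<subseteq> D(w)\<close>, prefixing \<open>T\<close>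
  is a bijection from the commutation classes of \<open>Tw\<close> to the classes \<open>c\<close> of \<open>w\<close> with \<open>T \<subseteq> L(c)\<close>,
  so the formula is inclusion-exclusion over the sets \<open>{c. a \<in> L(c)}\<close>, \<open>a \<in> D(w)\<close>.

  That \<open>T\<close> can be split off reducedly from \<open>w\<close> is the exchange property together with the fact that
  distinct generators are distinct in \<open>W\<close>. These two facts also show that \<open>D(w)\<close> and the set of
  reduced words of \<open>w\<close> are finite even if \<open>S\<close> is infinite. The exchange property comes from the
  parity of the number of times a reflection occurs in the reflection sequence of a word, which is
  invariant under the Coxeter relations; distinctness of the generators comes from the (dual)
  geometric representation.\<close>

section \<open>Calculating with words\<close>

lemmas [trans] = word_equiv.trans

lemma word_equiv_refl: "set u \<subseteq> gens \<Gamma> \<Longrightarrow> word_equiv \<Gamma> u u"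
  by (rule word_equiv.refl) auto

lemma word_equiv_set:
  assumes "word_equiv \<Gamma> u v"
  shows "set u \<subseteq> gens \<Gamma>" "set v \<subseteq> gens \<Gamma>"
  using word_equiv_lists[OF assms] by auto

lemma word_equiv_prefix:
  assumes "word_equiv \<Gamma> u v" "set x \<subseteq> gens \<Gamma>"
  shows "word_equiv \<Gamma> (x @ u) (x @ v)"
  using assms by (intro word_equiv_append word_equiv_refl)

lemma word_equiv_suffix:
  assumes "word_equiv \<Gamma> u v" "set y \<subseteq> gens \<Gamma>"
  shows "word_equiv \<Gamma> (u @ y) (v @ y)"
  using assms by (intro word_equiv_append word_equiv_refl)

lemma word_equiv_rev_append_cancel:
  assumes "set x \<subseteq> gens \<Gamma>" "set u \<subseteq> gens \<Gamma>"
  shows "word_equiv \<Gamma> (rev x @ x @ u) u"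
  using word_equiv_suffix[OF word_equiv_rev_cancel[of x \<Gamma>], of u] assms by auto

lemma word_equiv_append_rev_cancel:
  assumes "set x \<subseteq> gens \<Gamma>" "set u \<subseteq> gens \<Gamma>"
  shows "word_equiv \<Gamma> (x @ rev x @ u) u"
  using word_equiv_rev_append_cancel[of "rev x" \<Gamma> u] assms by simp

lemma word_equiv_move_left:
  assumes "set x \<subseteq> gens \<Gamma>" "set u \<subseteq> gens \<Gamma>"
  shows "word_equiv \<Gamma> (x @ u) v \<longleftrightarrow> word_equiv \<Gamma> u (rev x @ v)"
proof
  assume "word_equiv \<Gamma> (x @ u) v"
  then have "word_equiv \<Gamma> (rev x @ x @ u) (rev x @ v)"
    using assms by (intro word_equiv_prefix) auto
  then show "word_equiv \<Gamma> u (rev x @ v)"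
    using word_equiv_rev_append_cancel[OF assms] by (meson word_equiv.trans word_equiv.sym)
next
  assume r: "word_equiv \<Gamma> u (rev x @ v)"
  then have "word_equiv \<Gamma> (x @ u) (x @ rev x @ v)"
    using assms by (intro word_equiv_prefix) auto
  also have "word_equiv \<Gamma> (x @ rev x @ v) v"
    using word_equiv_set[OF r] assms by (intro word_equiv_append_rev_cancel) auto
  finally show "word_equiv \<Gamma> (x @ u) v" .
qed

lemma word_equiv_move_right:
  assumes "set y \<subseteq> gens \<Gamma>" "set u \<subseteq> gens \<Gamma>"
  shows "word_equiv \<Gamma> (u @ y) v \<longleftrightarrow> word_equiv \<Gamma> u (v @ rev y)"
proof
  assume "word_equiv \<Gamma> (u @ y) v"
  then have "word_equiv \<Gamma> (u @ y @ rev y) (v @ rev y)"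
    using word_equiv_suffix[of \<Gamma> "u @ y" v "rev y"] assms by simp
  moreover have "word_equiv \<Gamma> (u @ y @ rev y) u"
    using word_equiv_prefix[OF word_equiv_append_rev_cancel[of y \<Gamma> "[]"], of u] assms by simp
  ultimately show "word_equiv \<Gamma> u (v @ rev y)"
    by (meson word_equiv.trans word_equiv.sym)
next
  assume r: "word_equiv \<Gamma> u (v @ rev y)"
  then have "word_equiv \<Gamma> (u @ y) (v @ rev y @ y)"
    using word_equiv_suffix[OF r, of y] assms by simp
  also have "word_equiv \<Gamma> (v @ rev y @ y) v"
    using word_equiv_prefix[OF word_equiv_rev_append_cancel[of y \<Gamma> "[]"], of v]
      word_equiv_set[OF r] assms by simp
  finally show "word_equiv \<Gamma> (u @ y) v" .
qed

lemma word_equiv_conjugate: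
  assumes "set x \<subseteq> gens \<Gamma>" "set r \<subseteq> gens \<Gamma>"
  shows "word_equiv \<Gamma> (rev x @ r @ x) s \<longleftrightarrow> word_equiv \<Gamma> r (x @ s @ rev x)"
  using assms word_equiv_move_left[of "rev x" \<Gamma> "r @ x" s] word_equiv_move_right[of x \<Gamma> r "x @ s"]
  by simp

lemma word_equiv_cong_left:
  assumes "word_equiv \<Gamma> u v"
  shows "word_equiv \<Gamma> u t \<longleftrightarrow> word_equiv \<Gamma> v t"
  using assms by (meson word_equiv.trans word_equiv.sym)

lemma word_equiv_cong_right:
  assumes "word_equiv \<Gamma> u v"
  shows "word_equiv \<Gamma> t u \<longleftrightarrow> word_equiv \<Gamma> t v"
  using assms by (meson word_equiv.trans word_equiv.sym)

lemma word_equiv_involution: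
  assumes "a \<in> gens \<Gamma>" "set u \<subseteq> gens \<Gamma>"
  shows "word_equiv \<Gamma> (a # a # u) u"
  using word_equiv_rev_append_cancel[of "[a]" \<Gamma> u] assms by simp

lemma word_equiv_Cons_iff:
  assumes "a \<in> gens \<Gamma>" "set u \<subseteq> gens \<Gamma>"
  shows "word_equiv \<Gamma> (a # u) v \<longleftrightarrow> word_equiv \<Gamma> u (a # v)"
  using word_equiv_move_left[of "[a]" \<Gamma> u v] assms by simp

lemma word_equiv_commute:
  assumes "a \<in> gens \<Gamma>" "b \<in> gens \<Gamma>" "\<not> adjacent \<Gamma> a b"
  shows "word_equiv \<Gamma> [a, b] [b, a]"
proof (cases "a = b")
  case True
  then show ?thesis using word_equiv_refl[of "[a, a]" \<Gamma>] assms by simp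
next
  case False
  then show ?thesis
    using word_equiv.relation[of \<Gamma> "[a,b]" "[b,a]" "[]" "[]"] assms coxeter_relation.commutation[of a \<Gamma> b]
    by simp
qed

lemma word_equiv_commute_past:
  assumes "a \<in> gens \<Gamma>" "set x \<subseteq> gens \<Gamma>" "\<forall>b\<in>set x. \<not> adjacent \<Gamma> a b"
  shows "word_equiv \<Gamma> (a # x) (x @ [a])"
  using assms
proof (induction x)
  case Nil
  then show ?case by (auto intro: word_equiv_refl)
next
  case (Cons b x)
  have "word_equiv \<Gamma> (a # b # x) (b # a # x)"
    using word_equiv_suffix[OF word_equiv_commute[of a \<Gamma> b], of x] Cons.prems by auto
  also have "word_equiv \<Gamma> (b # a # x) (b # x @ [a])"
    using word_equiv_prefix[of \<Gamma> "a # x" "x @ [a]" "[b]"] Cons by auto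
  finally show ?case by simp
qed

lemma adjacent_sym: "adjacent \<Gamma> a b \<longleftrightarrow> adjacent \<Gamma> b a"
  by (simp add: adjacent_def insert_commute)


section \<open>Alternating words\<close>

lemma alternating_add:
  "alternating (m + n) a b =
    alternating m a b @ (if even m then alternating n a b else alternating n b a)"
  by (induction m arbitrary: a b) auto

lemma alternating_Suc_snoc:
  "alternating (Suc n) a b = alternating n a b @ [if even n then a else b]"
  using alternating_add[of n 1 a b] by simp

lemma rev_alternating:
  "rev (alternating n a b) = (if odd n then alternating n a b else alternating n b a)"
proof (induction n arbitrary: a b)
  case (Suc n)
  have "rev (alternating (Suc n) a b) = rev (alternating n b a) @ [a]"
    by simp
  also have "\<dots> = (if odd (Suc n) then alternating (Suc n) a b else alternating (Suc n) b a)"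
    by (simp add: Suc.IH alternating_Suc_snoc del: alternating.simps)
  finally show ?case .
qed simp

lemma set_alternating: "set (alternating n a b) \<subseteq> {a, b}"
  by (induction n arbitrary: a b) auto

lemma alternating_set_gens:
  assumes "a \<in> gens \<Gamma>" "b \<in> gens \<Gamma>"
  shows "set (alternating n a b) \<subseteq> gens \<Gamma>"
  using set_alternating[of n a b] assms by blast

text \<open>The two odd words multiply to an alternating word of length \<open>2 * k\<close>, which
  splits into one side of the braid relation and the inverse of the other, hence is trivial. Odd
  alternating words are palindromes, so each is its own inverse.\<close>

lemma alternating_odd_flip:
  assumes ab: "a \<in> gens \<Gamma>" "b \<in> gens \<Gamma>"
    and braid: "word_equiv \<Gamma> (alternating k a b) (alternating k b a)" and "i < k"
  shows "word_equiv \<Gamma> (alternating (2 * i + 1) b a) (alternating (2 * (k - Suc i) + 1) a b)"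
proof -
  let ?x = "alternating (2 * i + 1) b a" and ?y = "alternating (2 * (k - Suc i) + 1) a b"
  have gens: "set (alternating n a b) \<subseteq> gens \<Gamma>" "set (alternating n b a) \<subseteq> gens \<Gamma>" for n
    using ab by (simp_all add: alternating_set_gens)
  have "2 * i + 1 + (2 * (k - Suc i) + 1) = k + k"
    using \<open>i < k\<close> by simp
  then have "?x @ ?y = alternating (k + k) b a"
    using alternating_add[of "2 * i + 1" "2 * (k - Suc i) + 1" b a] by simp
  also have "\<dots> = alternating k b a @ rev (alternating k a b)"
    by (simp add: alternating_add rev_alternating)
  finally have eq: "?x @ ?y = alternating k b a @ rev (alternating k a b)" .
  have "word_equiv \<Gamma> (?x @ ?y) []"
    unfolding eq using gens braid
    by (subst word_equiv_move_right) (auto intro: word_equiv.sym)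
  then have "word_equiv \<Gamma> ?x (rev ?y)"
    using word_equiv_move_right[of ?y \<Gamma> ?x "[]"] gens by (simp del: alternating.simps)
  moreover have "rev ?y = ?y"
    by (subst rev_alternating) simp
  ultimately show ?thesis by simp
qed


section \<open>The exchange property\<close>

text \<open>For \<open>u = s\<^sub>1 \<dots> s\<^sub>n\<close> and a word \<open>r\<close>, this counts the indices \<open>i\<close> for which the reflection
  \<open>s\<^sub>1 \<dots> s\<^sub>i \<dots> s\<^sub>1\<close> equals \<open>r\<close> in the group. The count
  itself depends on the word \<open>u\<close>, only its parity is a function of the group element.\<close>

fun reflection_count :: "'a coxeter_graph \<Rightarrow> 'a list \<Rightarrow> 'a list \<Rightarrow> nat" where
  "reflection_count \<Gamma> [] r = 0"
| "reflection_count \<Gamma> (a # u) r =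
     of_bool (word_equiv \<Gamma> r [a]) + reflection_count \<Gamma> u (a # r @ [a])"

text \<open>A cocycle rule: a reflection contributed by \<open>y\<close> is conjugated by the
  preceding \<open>x\<close>, and passing from \<open>r\<close> to \<open>rev x @ r @ x\<close>
  undoes this.\<close>

lemma reflection_count_append:
  "reflection_count \<Gamma> (x @ y) r =
    reflection_count \<Gamma> x r + reflection_count \<Gamma> y (rev x @ r @ x)"
  by (induction x arbitrary: r) auto

lemma reflection_count_cong:
  assumes "word_equiv \<Gamma> r s" "set u \<subseteq> gens \<Gamma>"
  shows "reflection_count \<Gamma> u r = reflection_count \<Gamma> u s"
  using assms
proof (induction u arbitrary: r s)
  case (Cons a u)
  have "word_equiv \<Gamma> (a # r @ [a]) (a # s @ [a])"
    using word_equiv_prefix[OF word_equiv_suffix[OF Cons.prems(1), of "[a]"], of "[a]"] Cons.prems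
    by simp
  then show ?case
    using Cons word_equiv_cong_left[OF Cons.prems(1)] by simp
qed simp

text \<open>Conjugating a letter of an alternating word by the letters before it gives again an
  alternating word, of odd length.\<close>

lemma reflection_count_alternating:
  assumes "a \<in> gens \<Gamma>" "b \<in> gens \<Gamma>" "set r \<subseteq> gens \<Gamma>"
  shows "reflection_count \<Gamma> (alternating k a b) r =
    (\<Sum>i<k. of_bool (word_equiv \<Gamma> r (alternating (2 * i + 1) a b)))"
  using assms
proof (induction k arbitrary: a b r)
  case (Suc k)
  have step: "word_equiv \<Gamma> (a # r @ [a]) (alternating (2 * i + 1) b a) \<longleftrightarrow>
      word_equiv \<Gamma> r (alternating (2 * Suc i + 1) a b)" for i
  proof -
    have "[a] @ alternating (2 * i + 1) b a @ rev [a] = alternating (2 * Suc i + 1) a b"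
      using alternating_Suc_snoc[of "2 * i + 1" b a] by simp
    then show ?thesis
      using word_equiv_conjugate[of "[a]" \<Gamma> r "alternating (2 * i + 1) b a"] Suc.prems by simp
  qed
  have "reflection_count \<Gamma> (alternating (Suc k) a b) r =
      of_bool (word_equiv \<Gamma> r [a]) + reflection_count \<Gamma> (alternating k b a) (a # r @ [a])"
    by simp
  also have "reflection_count \<Gamma> (alternating k b a) (a # r @ [a]) =
      (\<Sum>i<k. of_bool (word_equiv \<Gamma> r (alternating (2 * Suc i + 1) a b)))"
    using Suc.prems step by (subst Suc.IH) auto
  also have "of_bool (word_equiv \<Gamma> r [a]) + \<dots> =
      (\<Sum>i<Suc k. of_bool (word_equiv \<Gamma> r (alternating (2 * i + 1) a b)))"
    by (subst sum.lessThan_Suc_shift) simp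
  finally show ?case .
qed simp

text \<open>In \<open>[a, a]\<close> both letters contribute the reflection \<open>a\<close>, so the
  count is 0 or 2. The two sides of a commutation or braid relation contribute the same reflections
  in opposite order, by \<open>alternating_odd_flip\<close> in the braid case.\<close>

lemma reflection_count_relation:
  assumes rel: "coxeter_relation \<Gamma> u v" and r: "set r \<subseteq> gens \<Gamma>"
  shows "even (reflection_count \<Gamma> u r) = even (reflection_count \<Gamma> v r)"
  using rel
proof cases
  case (involution a)
  have "word_equiv \<Gamma> (a # r @ [a]) [a] \<longleftrightarrow> word_equiv \<Gamma> r [a, a, a]"
    using word_equiv_conjugate[of "[a]" \<Gamma> r "[a]"] involution r by simp
  also have "\<dots> \<longleftrightarrow> word_equiv \<Gamma> r [a]"
    using involution by (intro word_equiv_cong_right word_equiv_involution) auto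
  finally show ?thesis using involution by simp
next
  case (commutation a b)
  have flip: "word_equiv \<Gamma> (c # r @ [c]) [d] \<longleftrightarrow> word_equiv \<Gamma> r [d]"
    if "c \<in> gens \<Gamma>" "d \<in> gens \<Gamma>" "\<not> adjacent \<Gamma> c d" for c d
  proof -
    have "word_equiv \<Gamma> [c, d, c] [d, c, c]"
      using word_equiv_suffix[OF word_equiv_commute[OF that], of "[c]"] that by simp
    also have "word_equiv \<Gamma> [d, c, c] [d]"
      using word_equiv_prefix[OF word_equiv_involution[of c \<Gamma> "[]"], of "[d]"] that by simp
    finally have "word_equiv \<Gamma> r [c, d, c] \<longleftrightarrow> word_equiv \<Gamma> r [d]"
      by (rule word_equiv_cong_right)
    then show ?thesis
      using word_equiv_conjugate[of "[c]" \<Gamma> r "[d]"] that r by simp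
  qed
  show ?thesis
    using commutation flip[of a b] flip[of b a] by (simp add: adjacent_sym)
next
  case (braid a b k)
  have eq: "word_equiv \<Gamma> (alternating k a b) (alternating k b a)"
    using word_equiv.relation[OF rel, of "[]" "[]"] braid by simp
  have "reflection_count \<Gamma> (alternating k b a) r =
      (\<Sum>i<k. of_bool (word_equiv \<Gamma> r (alternating (2 * i + 1) b a)))"
    using braid r by (intro reflection_count_alternating)
  also have "\<dots> = (\<Sum>i<k. of_bool (word_equiv \<Gamma> r (alternating (2 * (k - Suc i) + 1) a b)))"
    using word_equiv_cong_right[OF alternating_odd_flip[OF braid(3,4) eq]] by (intro sum.cong) auto
  also have "\<dots> = (\<Sum>i<k. of_bool (word_equiv \<Gamma> r (alternating (2 * i + 1) a b)))"
    by (rule sum.nat_diff_reindex)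
  also have "\<dots> = reflection_count \<Gamma> (alternating k a b) r"
    using braid r by (intro reflection_count_alternating[symmetric])
  finally show ?thesis using braid by simp
qed

text \<open>In a context \<open>x\<close>, \<open>y\<close> the prefix counts alike on both sides,
  the middle is covered by the defining relations, and the suffix is evaluated at conjugates of
  \<open>r\<close> by \<open>u\<close> and by \<open>v\<close>, which are equal in the
  group.\<close>

lemma reflection_count_parity:
  assumes "word_equiv \<Gamma> u v" "set r \<subseteq> gens \<Gamma>"
  shows "even (reflection_count \<Gamma> u r) = even (reflection_count \<Gamma> v r)"
  using assms
proof (induction arbitrary: r rule: word_equiv.induct)
  case (relation u v x y)
  let ?r = "rev x @ r @ x"
  have gens: "set x \<subseteq> gens \<Gamma>" "set y \<subseteq> gens \<Gamma>" "set ?r \<subseteq> gens \<Gamma>"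
    using relation by auto
  have uv: "word_equiv \<Gamma> u v"
    using word_equiv.relation[OF relation(1), of "[]" "[]"] by simp
  have "word_equiv \<Gamma> (rev u) (rev v)"
  proof -
    have "word_equiv \<Gamma> (v @ rev u) []"
      using uv word_equiv_set[OF uv]
      by (subst word_equiv_move_right) (auto intro: word_equiv.sym)
    then show ?thesis
      using word_equiv_move_left[of v \<Gamma> "rev u" "[]"] word_equiv_set[OF uv] by simp
  qed
  then have "word_equiv \<Gamma> (rev u @ ?r @ u) (rev v @ ?r @ v)"
    using uv gens by (intro word_equiv_append word_equiv_refl)
  then have "reflection_count \<Gamma> y (rev u @ ?r @ u) = reflection_count \<Gamma> y (rev v @ ?r @ v)"
    using gens by (intro reflection_count_cong)
  moreover have "even (reflection_count \<Gamma> u ?r) = even (reflection_count \<Gamma> v ?r)"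
    using relation(1) gens by (intro reflection_count_relation)
  ultimately show ?case
    by (simp add: reflection_count_append)
qed auto

lemma reflection_count_pos:
  assumes "reflection_count \<Gamma> u r > 0"
  shows "\<exists>x b y. u = x @ b # y \<and> word_equiv \<Gamma> (rev x @ r @ x) [b]"
  using assms
proof (induction u arbitrary: r)
  case (Cons a u)
  show ?case
  proof (cases "word_equiv \<Gamma> r [a]")
    case True
    then show ?thesis by (intro exI[of _ "[]"]) auto
  next
    case False
    then have "reflection_count \<Gamma> u (a # r @ [a]) > 0" using Cons.prems by simp
    then obtain x b y where "u = x @ b # y" "word_equiv \<Gamma> (rev x @ (a # r @ [a]) @ x) [b]"
      using Cons.IH by blast
    then show ?thesis by (intro exI[of _ "a # x"]) auto
  qed
qed simp

text \<open>An odd count is positive, so \<open>a\<close> equals some reflection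
  \<open>x b x^-1\<close> of \<open>u = x b y\<close>. Then
  \<open>a u = x b x^-1 x b y = x y\<close>.\<close>

lemma reflection_count_odd_exchange:
  assumes "odd (reflection_count \<Gamma> u [a])" "a \<in> gens \<Gamma>" "set u \<subseteq> gens \<Gamma>"
  obtains x b y where "u = x @ b # y" "word_equiv \<Gamma> [a] (x @ b # rev x)"
    "word_equiv \<Gamma> (a # u) (x @ y)"
proof -
  obtain x b y where u: "u = x @ b # y" and eq: "word_equiv \<Gamma> (rev x @ [a] @ x) [b]"
    using reflection_count_pos[of \<Gamma> u "[a]"] odd_pos[OF assms(1)] by blast
  have gens: "set x \<subseteq> gens \<Gamma>" "b \<in> gens \<Gamma>" "set y \<subseteq> gens \<Gamma>"
    using u assms(3) by auto
  have a: "word_equiv \<Gamma> [a] (x @ b # rev x)"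
    using word_equiv_conjugate[of x \<Gamma> "[a]" "[b]"] eq gens assms(2) by simp
  have "word_equiv \<Gamma> (a # u) (x @ b # rev x @ x @ b # y)"
    using word_equiv_suffix[OF a assms(3)] u by simp
  also have "word_equiv \<Gamma> (x @ b # rev x @ x @ b # y) (x @ b # b # y)"
    using word_equiv_prefix[OF word_equiv_rev_append_cancel[of x \<Gamma> "b # y"], of "x @ [b]"] gens
    by simp
  also have "word_equiv \<Gamma> (x @ b # b # y) (x @ y)"
    using gens by (intro word_equiv_prefix word_equiv_involution)
  finally show thesis using that u a by blast
qed

section \<open>Reduced words and exchange of a letter\<close>

lemma reduced_set: "reduced \<Gamma> u \<Longrightarrow> set u \<subseteq> gens \<Gamma>"
  by (auto simp: reduced_def)

lemma reduced_le: "reduced \<Gamma> u \<Longrightarrow> word_equiv \<Gamma> u v \<Longrightarrow> length u \<le> length v"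
  by (simp add: reduced_def)

lemma reducedI:
  assumes "reduced \<Gamma> u" "word_equiv \<Gamma> u v" "length v \<le> length u"
  shows "reduced \<Gamma> v"
proof -
  have "length v \<le> length t" if "word_equiv \<Gamma> v t" for t
    using reduced_le[OF assms(1) word_equiv.trans[OF assms(2) that]] assms(3) by simp
  then show ?thesis
    using word_equiv_lists[OF assms(2)] by (simp add: reduced_def)
qed

lemma reduced_length_eq:
  assumes "reduced \<Gamma> u" "reduced \<Gamma> v" "word_equiv \<Gamma> u v"
  shows "length u = length v"
  using assms by (meson reduced_le word_equiv.sym le_antisym)

lemma ex_reduced:
  assumes "set u \<subseteq> gens \<Gamma>"
  obtains v where "word_equiv \<Gamma> u v" "reduced \<Gamma> v"
proof -
  have "u \<in> lists (gens \<Gamma>)" using assms by auto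
  then have "word_class \<Gamma> u \<in> carrier (coxeter_group \<Gamma>)"
    unfolding carrier_coxeter_group by blast
  then show thesis
    using reduced_words_nonempty that by (fastforce simp: reduced_words_def)
qed

text \<open>If the count of \<open>a\<close> in \<open>u\<close> is even, the extra letter in
  \<open>a # u\<close> makes it odd there, because conjugation by \<open>a\<close> fixes
  \<open>a\<close>. Parity carries this over to a reduced word \<open>v\<close> of
  \<open>a u\<close>. Deleting a letter of \<open>v\<close> would then express
  \<open>u = a v\<close> by fewer letters than \<open>v\<close> has, although \<open>v\<close> is
  already shorter than \<open>u\<close>.\<close>

lemma exchange:
  assumes red: "reduced \<Gamma> u" and a: "a \<in> gens \<Gamma>"
    and desc: "word_equiv \<Gamma> (a # u) t" "length t < length u"
  obtains x b y where "u = x @ b # y" "word_equiv \<Gamma> [a] (x @ b # rev x)"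
    "word_equiv \<Gamma> (a # u) (x @ y)"
proof (cases "odd (reflection_count \<Gamma> u [a])")
  case True
  then show thesis
    using reflection_count_odd_exchange a reduced_set[OF red] that by metis
next
  case False
  have gu: "set u \<subseteq> gens \<Gamma>" using red by (rule reduced_set)
  obtain v where v: "word_equiv \<Gamma> (a # u) v" "reduced \<Gamma> v"
    using ex_reduced[of "a # u" \<Gamma>] a gu by auto
  have gv: "set v \<subseteq> gens \<Gamma>" using v(2) by (rule reduced_set)
  have "length v \<le> length t"
    using v desc by (meson reduced_le word_equiv.trans word_equiv.sym)
  have "reflection_count \<Gamma> u [a, a, a] = reflection_count \<Gamma> u [a]"
    using word_equiv_involution[of a \<Gamma> "[a]"] a gu by (intro reflection_count_cong) auto
  then have "odd (reflection_count \<Gamma> (a # u) [a])"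
    using False word_equiv_refl[of "[a]" \<Gamma>] a by simp
  then have "odd (reflection_count \<Gamma> v [a])"
    using reflection_count_parity[OF v(1), of "[a]"] a by simp
  then obtain x b y where xy: "v = x @ b # y" "word_equiv \<Gamma> (a # v) (x @ y)"
    using reflection_count_odd_exchange a gv by metis
  have "word_equiv \<Gamma> u (a # v)"
    using v(1) word_equiv_Cons_iff[OF a gu] by blast
  then have "length u \<le> length (x @ y)"
    using reduced_le[OF red] xy(2) word_equiv.trans by blast
  then show thesis
    using xy(1) \<open>length v \<le> length t\<close> desc(2) by simp
qed


section \<open>Distinct generators are distinct in the group\<close>

text \<open>For distinct generators this is minus the standard bilinear form on the simple roots.
  Commuting generators get 0, the cosine for m = 2, and the label \<infinity> gets the limit value
  1.\<close>

definition cos_label :: "'a coxeter_graph \<Rightarrow> 'a \<Rightarrow> 'a \<Rightarrow> real" where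
  "cos_label \<Gamma> a b =
     (if adjacent \<Gamma> a b then (case label \<Gamma> {a, b} of enat m \<Rightarrow> cos (pi / real m) | \<infinity> \<Rightarrow> 1) else 0)"

text \<open>The contragredient of the geometric representation, in the coordinates given by the simple
  roots. Unlike the geometric representation itself, it needs no finiteness of supports.\<close>

definition dual_reflection :: "'a coxeter_graph \<Rightarrow> 'a \<Rightarrow> ('a \<Rightarrow> real) \<Rightarrow> 'a \<Rightarrow> real" where
  "dual_reflection \<Gamma> a f =
     (\<lambda>t. if t = a then - f a else f t + 2 * cos_label \<Gamma> a t * f a)"

lemma cos_label_sym: "cos_label \<Gamma> a b = cos_label \<Gamma> b a"
  by (simp add: cos_label_def adjacent_sym insert_commute)

text \<open>The closed form comes from the Chebyshev recursion sin (A + \<theta>) = 2 cos \<theta>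
  sin A - sin (A - \<theta>). The first equation is about the coordinate to be reflected next, the
  second about the other one. The factor \<open>sin \<theta>\<close> avoids a division.\<close>

lemma dual_reflection_alternating_pair:
  fixes f :: "'a \<Rightarrow> real"
  assumes "a \<noteq> b" "cos_label \<Gamma> a b = cos \<theta>"
  shows "sin \<theta> * fold (dual_reflection \<Gamma>) (alternating n a b) f (if even n then a else b) =
           f a * sin (real (Suc n) * \<theta>) + f b * sin (real n * \<theta>)
       \<and> sin \<theta> * fold (dual_reflection \<Gamma>) (alternating n a b) f (if even n then b else a) =
           - (f a * sin (real n * \<theta>) + f b * sin ((real n - 1) * \<theta>))"
proof (induction n)
  case (Suc n)
  let ?F = "\<lambda>n. fold (dual_reflection \<Gamma>) (alternating n a b) f"
  let ?next = "if even n then a else b" and ?last = "if even n then b else a"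
  have F: "?F (Suc n) = dual_reflection \<Gamma> ?next (?F n)"
    unfolding alternating_Suc_snoc by simp
  have c: "cos_label \<Gamma> ?next ?last = cos \<theta>"
    using assms(2) by (simp add: cos_label_sym)
  have next': "?F (Suc n) ?next = - ?F n ?next"
    unfolding F by (simp add: dual_reflection_def)
  have last': "?F (Suc n) ?last = ?F n ?last + 2 * cos \<theta> * ?F n ?next"
    unfolding F c[symmetric] using assms(1) by (simp add: dual_reflection_def)
  have sum: "sin (A + \<theta>) = 2 * cos \<theta> * sin A - sin (A - \<theta>)" for A
    by (simp add: sin_add sin_diff)
  have s1: "sin (real (Suc (Suc n)) * \<theta>) = 2 * cos \<theta> * sin (real (Suc n) * \<theta>) - sin (real n * \<theta>)"
    using sum[of "real (Suc n) * \<theta>"] by (simp add: algebra_simps)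
  have s2: "sin (real (Suc n) * \<theta>) = 2 * cos \<theta> * sin (real n * \<theta>) - sin ((real n - 1) * \<theta>)"
    using sum[of "real n * \<theta>"] by (simp add: algebra_simps)
  have "sin \<theta> * ?F (Suc n) ?last = sin \<theta> * ?F n ?last + 2 * cos \<theta> * (sin \<theta> * ?F n ?next)"
    by (simp only: last' distrib_left mult.left_commute mult.assoc)
  also have "\<dots> = - (f a * sin (real n * \<theta>) + f b * sin ((real n - 1) * \<theta>))
      + 2 * cos \<theta> * (f a * sin (real (Suc n) * \<theta>) + f b * sin (real n * \<theta>))"
    by (simp only: Suc.IH)
  also have "\<dots> = f a * sin (real (Suc (Suc n)) * \<theta>) + f b * sin (real (Suc n) * \<theta>)"
    unfolding s1 unfolding s2 by (simp add: algebra_simps)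
  finally have 1: "sin \<theta> * ?F (Suc n) ?last =
      f a * sin (real (Suc (Suc n)) * \<theta>) + f b * sin (real (Suc n) * \<theta>)" .
  have "sin \<theta> * ?F (Suc n) ?next = - (sin \<theta> * ?F n ?next)"
    by (simp only: next' mult_minus_right)
  also have "\<dots> = - (f a * sin (real (Suc n) * \<theta>) + f b * sin (real n * \<theta>))"
    by (simp only: Suc.IH)
  finally have 2: "sin \<theta> * ?F (Suc n) ?next =
      - (f a * sin (real (Suc n) * \<theta>) + f b * sin (real n * \<theta>))" .
  show ?case
    using 1 2 by (cases "even n") simp_all
qed simp

text \<open>For \<theta> = \<pi>/m the closed form shows that either product negates the coordinates
  at \<open>a\<close> and \<open>b\<close>, and also exchanges them if m is odd. Every other
  coordinate is then fixed by a linear invariant.\<close>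

lemma dual_reflection_braid:
  fixes f :: "'a \<Rightarrow> real"
  assumes "a \<noteq> b" and c: "cos_label \<Gamma> a b = cos (pi / real m)" and "m \<ge> 2"
  shows "fold (dual_reflection \<Gamma>) (alternating m a b) f =
    fold (dual_reflection \<Gamma>) (alternating m b a) f"
proof
  fix t
  define \<theta> where "\<theta> = pi / real m"
  let ?F = "fold (dual_reflection \<Gamma>) (alternating m a b) f"
    and ?G = "fold (dual_reflection \<Gamma>) (alternating m b a) f"
  have m\<theta>: "real m * \<theta> = pi" and "\<theta> > 0" "\<theta> < pi"
    using \<open>m \<ge> 2\<close> by (simp_all add: \<theta>_def divide_less_eq)
  then have sin: "sin \<theta> > 0" by (intro sin_gt_zero)
  have s: "sin (real (Suc m) * \<theta>) = - sin \<theta>" "sin ((real m - 1) * \<theta>) = sin \<theta>"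
    using m\<theta> by (simp_all add: algebra_simps)
  have pair: "fold (dual_reflection \<Gamma>) (alternating m p q) f (if even m then p else q) = - f p
      \<and> fold (dual_reflection \<Gamma>) (alternating m p q) f (if even m then q else p) = - f q"
    if "p \<noteq> q" "cos_label \<Gamma> p q = cos \<theta>" for p q
  proof -
    have "sin \<theta> * fold (dual_reflection \<Gamma>) (alternating m p q) f (if even m then p else q) = sin \<theta> * - f p"
      "sin \<theta> * fold (dual_reflection \<Gamma>) (alternating m p q) f (if even m then q else p) = sin \<theta> * - f q"
      using dual_reflection_alternating_pair[OF that, of m f] unfolding s m\<theta> by simp_all
    then show ?thesis using sin mult_cancel_left by (metis less_irrefl)
  qed
  have ab: "?F a = ?G a" "?F b = ?G b"
    using pair[of a b] pair[of b a] c assms(1)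
    by (cases "even m"; simp add: \<theta>_def cos_label_sym)+
  show "?F t = ?G t"
  proof (cases "t = a \<or> t = b")
    case True
    then show ?thesis using ab by blast
  next
    case False
    \<comment> \<open>Both reflections fix a linear form in the coordinates \<open>t, a, b\<close>, so that the coordinate
      \<open>t\<close> of the image is determined by the other two.\<close>
    define p q where "p = cos_label \<Gamma> a t" and "q = cos_label \<Gamma> b t"
    \<comment> \<open>Invariance of \<open>I\<close> under the two reflections means
      \<open>p = \<alpha> - cos \<theta> * \<beta>\<close> and
      \<open>q = \<beta> - cos \<theta> * \<alpha>\<close>. This is the solution by Cramer's rule,
      with determinant \<open>1 - (cos \<theta>)\<^sup>2\<close>.\<close>
    define \<alpha> \<beta> where "\<alpha> = (p + cos \<theta> * q) / (sin \<theta>)\<^sup>2" and "\<beta> = (q + cos \<theta> * p) / (sin \<theta>)\<^sup>2"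
    define I where "I g = g t + \<alpha> * g a + \<beta> * g b" for g :: "'a \<Rightarrow> real"
    have sin2: "(sin \<theta>)\<^sup>2 \<noteq> 0" using sin by simp
    have p: "p = \<alpha> - cos \<theta> * \<beta>"
    proof -
      have "\<alpha> - cos \<theta> * \<beta> = p * (1 - (cos \<theta>)\<^sup>2) / (sin \<theta>)\<^sup>2"
        by (simp add: \<alpha>_def \<beta>_def algebra_simps power2_eq_square add_divide_distrib diff_divide_distrib)
      then show ?thesis using sin2 by (simp add: sin_squared_eq)
    qed
    have q: "q = \<beta> - cos \<theta> * \<alpha>"
    proof -
      have "\<beta> - cos \<theta> * \<alpha> = q * (1 - (cos \<theta>)\<^sup>2) / (sin \<theta>)\<^sup>2"
        by (simp add: \<alpha>_def \<beta>_def algebra_simps power2_eq_square add_divide_distrib diff_divide_distrib)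
      then show ?thesis using sin2 by (simp add: sin_squared_eq)
    qed
    have "cos_label \<Gamma> b a = cos \<theta>" "cos_label \<Gamma> a b = cos \<theta>"
      using c by (simp_all add: \<theta>_def cos_label_sym)
    then have inv: "I (dual_reflection \<Gamma> a g) = I g" "I (dual_reflection \<Gamma> b g) = I g" for g
      using False assms(1)
      by (auto simp: I_def dual_reflection_def p_def[symmetric] q_def[symmetric] p q algebra_simps)
    have "I (fold (dual_reflection \<Gamma>) u g) = I g" if "set u \<subseteq> {a, b}" for u g
      using that by (induction u arbitrary: g) (auto simp: inv)
    then have "I ?F = I ?G"
      using set_alternating[of m a b] set_alternating[of m b a] by (simp add: insert_commute)
    then show ?thesis using ab by (simp add: I_def)
  qed
qed

lemma dual_reflection_word_equiv:
  assumes "is_coxeter_graph \<Gamma>" "word_equiv \<Gamma> u v"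
  shows "fold (dual_reflection \<Gamma>) u = fold (dual_reflection \<Gamma>) v"
  using assms(2)
proof (induction rule: word_equiv.induct)
  case (relation u v x y)
  from relation(1) have "fold (dual_reflection \<Gamma>) u = fold (dual_reflection \<Gamma>) v"
  proof cases
    case (involution a)
    then show ?thesis by (auto simp: fun_eq_iff dual_reflection_def)
  next
    case (commutation a b)
    then have "cos_label \<Gamma> a b = 0" "cos_label \<Gamma> b a = 0"
      by (simp_all add: cos_label_def adjacent_sym)
    then show ?thesis using commutation by (auto simp: fun_eq_iff dual_reflection_def)
  next
    case (braid a b k)
    then have e: "{a, b} \<in> edges \<Gamma>" by (simp add: adjacent_def)
    then have "card {a, b} = 2" "label \<Gamma> {a, b} \<ge> 3"
      using assms(1) by (auto simp: is_coxeter_graph_def)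
    then have "a \<noteq> b" "k \<ge> 3"
      using braid by (auto simp: numeral_eq_enat)
    then show ?thesis
      using braid dual_reflection_braid[of a b \<Gamma> k] by (auto simp: cos_label_def)
  qed
  then show ?case by simp
qed simp_all

text \<open>The reflection at \<open>a\<close> negates the coordinate at \<open>a\<close> of the
  indicator function of \<open>a\<close>, while the reflection at any other \<open>b\<close> leaves
  it equal to 1.\<close>

lemma generators_distinct:
  assumes "is_coxeter_graph \<Gamma>" "word_equiv \<Gamma> [a] [b]"
  shows "a = b"
proof (rule ccontr)
  assume "a \<noteq> b"
  have "dual_reflection \<Gamma> a (\<lambda>t. of_bool (t = a)) a = dual_reflection \<Gamma> b (\<lambda>t. of_bool (t = a)) a"
    using dual_reflection_word_equiv[OF assms] by (simp add: fun_eq_iff)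
  with \<open>a \<noteq> b\<close> show False by (simp add: dual_reflection_def)
qed

section \<open>Descents\<close>

lemma word_class_carrier: "set u \<subseteq> gens \<Gamma> \<Longrightarrow> word_class \<Gamma> u \<in> carrier (coxeter_group \<Gamma>)"
  unfolding carrier_coxeter_group by (rule imageI) auto

lemma mult_word_class:
  assumes "set u \<subseteq> gens \<Gamma>" "set v \<subseteq> gens \<Gamma>"
  shows "word_class \<Gamma> u \<otimes>\<^bsub>coxeter_group \<Gamma>\<^esub> word_class \<Gamma> v = word_class \<Gamma> (u @ v)"
  using assms by (intro mult_coxeter_group) auto

lemma mem_reduced_words:
  "v \<in> reduced_words \<Gamma> (word_class \<Gamma> u) \<longleftrightarrow> word_equiv \<Gamma> u v \<and> reduced \<Gamma> v"
  by (simp add: reduced_words_def)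

lemma cox_length_word_class:
  assumes "word_equiv \<Gamma> u v" "reduced \<Gamma> v"
  shows "cox_length \<Gamma> (word_class \<Gamma> u) = length v"
  using assms word_equiv_set(1)[OF assms(1)]
  by (intro cox_length_eq word_class_carrier) (auto simp: mem_reduced_words)

lemma reduced_append_right:
  assumes "reduced \<Gamma> (x @ y)"
  shows "reduced \<Gamma> y"
proof -
  have gens: "set x \<subseteq> gens \<Gamma>" "set y \<subseteq> gens \<Gamma>"
    using reduced_set[OF assms] by auto
  have "length y \<le> length v" if "word_equiv \<Gamma> y v" for v
    using reduced_le[OF assms word_equiv_prefix[OF that gens(1)]] by simp
  then show ?thesis using gens by (auto simp: reduced_def)
qed

text \<open>Descents are the possible first letters of reduced words: if \<open>v\<close> is reduced
  for \<open>a w\<close> and shorter than \<open>w\<close>, then \<open>a # v\<close> represents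
  \<open>w\<close> and is no longer than a reduced word, hence reduced.\<close>

lemma mem_left_descents:
  assumes red: "reduced \<Gamma> u"
  shows "a \<in> left_descents \<Gamma> (word_class \<Gamma> u) \<longleftrightarrow> (\<exists>v. reduced \<Gamma> (a # v) \<and> word_equiv \<Gamma> u (a # v))"
proof (cases "a \<in> gens \<Gamma>")
  case True
  have gu: "set u \<subseteq> gens \<Gamma>" using red by (rule reduced_set)
  obtain v where v: "word_equiv \<Gamma> (a # u) v" "reduced \<Gamma> v"
    using ex_reduced[of "a # u" \<Gamma>] True gu by auto
  have len: "cox_length \<Gamma> (word_class \<Gamma> u) = length u"
    using red gu by (intro cox_length_word_class word_equiv_refl)
  have len': "cox_length \<Gamma> (word_class \<Gamma> [a] \<otimes>\<^bsub>coxeter_group \<Gamma>\<^esub> word_class \<Gamma> u) = length v"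
    using mult_word_class[of "[a]" \<Gamma> u] cox_length_word_class[OF v] True gu by simp
  have "length v < length u \<longleftrightarrow> (\<exists>v. reduced \<Gamma> (a # v) \<and> word_equiv \<Gamma> u (a # v))"
  proof
    assume "length v < length u"
    moreover have "word_equiv \<Gamma> u (a # v)"
      using v(1) word_equiv_Cons_iff[OF True gu] by blast
    ultimately show "\<exists>v. reduced \<Gamma> (a # v) \<and> word_equiv \<Gamma> u (a # v)"
      using reducedI[OF red, of "a # v"] by auto
  next
    assume "\<exists>v. reduced \<Gamma> (a # v) \<and> word_equiv \<Gamma> u (a # v)"
    then obtain v' where v': "reduced \<Gamma> (a # v')" "word_equiv \<Gamma> u (a # v')" by blast
    then have "word_equiv \<Gamma> (a # u) v'"
      using word_equiv_Cons_iff[OF True gu] by blast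
    then have "length v \<le> length v'"
      using v by (meson reduced_le word_equiv.trans word_equiv.sym)
    then show "length v < length u"
      using reduced_length_eq[OF red v'] by simp
  qed
  then show ?thesis using True len len' by (simp add: left_descents_def)
next
  case False
  then show ?thesis using reduced_set by (fastforce simp: left_descents_def)
qed

lemma left_descent_exchange:
  assumes red: "reduced \<Gamma> u" and a: "a \<in> left_descents \<Gamma> (word_class \<Gamma> u)"
  obtains x b y where "u = x @ b # y" "word_equiv \<Gamma> [a] (x @ b # rev x)"
    "word_equiv \<Gamma> (a # u) (x @ y)"
proof -
  obtain v where v: "reduced \<Gamma> (a # v)" "word_equiv \<Gamma> u (a # v)"
    using a mem_left_descents[OF red] by blast
  have ag: "a \<in> gens \<Gamma>" using reduced_set[OF v(1)] by simp
  have "word_equiv \<Gamma> (a # u) v"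
    using v(2) word_equiv_Cons_iff[OF ag reduced_set[OF red]] by blast
  moreover have "length v < length u"
    using reduced_length_eq[OF red v] by simp
  ultimately show thesis
    using exchange[OF red ag] that by blast
qed

text \<open>By exchange every descent equals the reflection at some position of the fixed word
  \<open>u\<close>, and a position yields at most one generator since distinct generators are
  distinct in the group.\<close>

lemma finite_left_descents:
  assumes "is_coxeter_graph \<Gamma>" "reduced \<Gamma> u"
  shows "finite (left_descents \<Gamma> (word_class \<Gamma> u))"
proof -
  \<comment> \<open>Where the reflection is not a generator, \<open>THE\<close> is arbitrary, which
    is harmless as only an inclusion is shown.\<close>
  let ?r = "\<lambda>i. THE a. word_equiv \<Gamma> [a] (take i u @ u ! i # rev (take i u))"
  have "left_descents \<Gamma> (word_class \<Gamma> u) \<subseteq> ?r ` {..<length u}"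
  proof
    fix a assume "a \<in> left_descents \<Gamma> (word_class \<Gamma> u)"
    then obtain x b y where u: "u = x @ b # y" and a: "word_equiv \<Gamma> [a] (x @ b # rev x)"
      by (rule left_descent_exchange[OF assms(2)])
    have "?r (length x) = a"
    proof (rule the_equality)
      show "word_equiv \<Gamma> [a] (take (length x) u @ u ! length x # rev (take (length x) u))"
        using a u by simp
      fix a' assume "word_equiv \<Gamma> [a'] (take (length x) u @ u ! length x # rev (take (length x) u))"
      then have "word_equiv \<Gamma> [a'] [a]"
        using a u by (simp, meson word_equiv.trans word_equiv.sym)
      then show "a' = a" by (rule generators_distinct[OF assms(1)])
    qed
    then show "a \<in> ?r ` {..<length u}" using u by (intro image_eqI[of _ _ "length x"]) auto
  qed
  then show ?thesis by (rule finite_subset) simp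
qed

text \<open>Induction on the length: the first letter is one of finitely many descents
  \<open>a\<close>, and the rest is a reduced word of the shorter element
  \<open>a w\<close>.\<close>

lemma finite_reduced_words:
  assumes "is_coxeter_graph \<Gamma>" "reduced \<Gamma> u"
  shows "finite (reduced_words \<Gamma> (word_class \<Gamma> u))"
  using assms(2)
proof (induction u rule: length_induct)
  case (1 u)
  let ?D = "left_descents \<Gamma> (word_class \<Gamma> u)"
  let ?R = "\<lambda>u. reduced_words \<Gamma> (word_class \<Gamma> u)"
  have "?R u \<subseteq> {[]} \<union> (\<Union>a\<in>?D. (#) a ` ?R (a # u))"
  proof
    fix v assume "v \<in> ?R u"
    then have v: "word_equiv \<Gamma> u v" "reduced \<Gamma> v" by (simp_all add: mem_reduced_words)
    show "v \<in> {[]} \<union> (\<Union>a\<in>?D. (#) a ` ?R (a # u))"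
    proof (cases v)
      case (Cons a v')
      have "a \<in> ?D" using v Cons mem_left_descents[OF 1(2)] by blast
      moreover have "word_equiv \<Gamma> (a # u) v'"
        using v Cons word_equiv_Cons_iff[of a \<Gamma> u v'] reduced_set[OF v(2)] word_equiv_set[OF v(1)]
        by simp
      moreover have "reduced \<Gamma> v'"
        using v Cons reduced_append_right[of \<Gamma> "[a]" v'] by simp
      ultimately have "v' \<in> ?R (a # u)" by (simp add: mem_reduced_words)
      then show ?thesis using Cons \<open>a \<in> ?D\<close> by blast
    qed simp
  qed
  moreover have "finite (?R (a # u))" if a: "a \<in> ?D" for a
  proof -
    obtain v where v: "reduced \<Gamma> (a # v)" "word_equiv \<Gamma> u (a # v)"
      using a mem_left_descents[OF 1(2)] by blast
    have "word_equiv \<Gamma> (a # u) v"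
      using v(2) word_equiv_Cons_iff[of a \<Gamma> u v] reduced_set[OF v(1)] reduced_set[OF 1(2)] by auto
    moreover have "length v < length u"
      using reduced_length_eq[OF 1(2) v] by simp
    moreover have "reduced \<Gamma> v"
      using v reduced_append_right[of \<Gamma> "[a]" v] by simp
    ultimately have "finite (?R v)"
      using 1(1) by blast
    then show ?thesis
      by (simp only: word_class_eqI[OF \<open>word_equiv \<Gamma> (a # u) v\<close>])
  qed
  ultimately show ?case
    using finite_left_descents[OF assms(1) 1(2)] by (elim finite_subset) simp
qed

text \<open>The letters are split off one at a time. Exchange for the new descent \<open>t\<close>
  deletes a letter of \<open>xs @ v\<close>; this letter lies in \<open>v\<close>, so
  \<open>t # xs\<close> followed by what remains of \<open>v\<close> is a word for the same element,
  of the same length.\<close>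

lemma independent_descents_prefix:
  assumes cox: "is_coxeter_graph \<Gamma>" and red: "reduced \<Gamma> u"
    and "distinct xs" "independent_set \<Gamma> (set xs)"
    and "set xs \<subseteq> left_descents \<Gamma> (word_class \<Gamma> u)"
  shows "\<exists>v. reduced \<Gamma> (xs @ v) \<and> word_equiv \<Gamma> u (xs @ v)"
  using assms(3-5)
proof (induction xs)
  case Nil
  show ?case
    using red word_equiv_refl[OF reduced_set[OF red]] by auto
next
  case (Cons t xs)
  have "independent_set \<Gamma> (set xs)"
    using Cons.prems(2) by (simp add: independent_set_def)
  then obtain v where red': "reduced \<Gamma> (xs @ v)" and eq: "word_equiv \<Gamma> u (xs @ v)"
    using Cons.IH Cons.prems by auto
  have t: "t \<in> gens \<Gamma>" and xs: "set xs \<subseteq> gens \<Gamma>"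
    using Cons.prems by (auto simp: independent_set_def)
  have "t \<in> left_descents \<Gamma> (word_class \<Gamma> (xs @ v))"
    using Cons.prems word_class_eqI[OF eq] by simp
  then obtain x b y where xby: "xs @ v = x @ b # y" and conj: "word_equiv \<Gamma> [t] (x @ b # rev x)"
    and del: "word_equiv \<Gamma> (t # xs @ v) (x @ y)"
    by (rule left_descent_exchange[OF red'])
  \<comment> \<open>Otherwise \<open>b\<close> lies in \<open>xs\<close> and commutes with all of
    \<open>x\<close>, so \<open>t = x b x^-1\<close> collapses to \<open>b\<close>, against the
    distinctness of \<open>t # xs\<close>.\<close>
  have "length xs \<le> length x"
  proof (rule ccontr)
    assume "\<not> length xs \<le> length x"
    then have pre: "x = take (length x) xs" "b = xs ! length x"
      using arg_cong[OF xby, of "take (length x)"] arg_cong[OF xby, of "\<lambda>l. l ! length x"]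
      by (auto simp: nth_append)
    then obtain z where z: "xs = x @ b # z"
      using id_take_nth_drop[of "length x" xs] \<open>\<not> length xs \<le> length x\<close> by auto
    then have "b \<in> set xs" "set x \<subseteq> set xs" "b \<notin> set x"
      using Cons.prems(1) by auto
    then have b: "b \<in> gens \<Gamma>" "set x \<subseteq> gens \<Gamma>"
      using xs by auto
    have "\<not> adjacent \<Gamma> b c" if "c \<in> set x" for c
      using that Cons.prems(2) \<open>b \<in> set xs\<close> \<open>set x \<subseteq> set xs\<close> \<open>b \<notin> set x\<close>
      by (metis independent_set_def list.set_intros(2) subsetD)
    then have past: "word_equiv \<Gamma> (b # rev x) (rev x @ [b])"
      using b by (intro word_equiv_commute_past) auto
    note conj
    also have "word_equiv \<Gamma> (x @ b # rev x) (x @ rev x @ [b])"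
      using past b(2) by (rule word_equiv_prefix)
    also have "word_equiv \<Gamma> (x @ rev x @ [b]) [b]"
      using b by (intro word_equiv_append_rev_cancel) auto
    finally have "t = b" by (rule generators_distinct[OF cox])
    then show False using Cons.prems(1) \<open>b \<in> set xs\<close> by simp
  qed
  then have "take (length xs) x = xs"
    using arg_cong[OF xby, of "take (length xs)"] by simp
  then obtain x' where x: "x = xs @ x'"
    using append_take_drop_id[of "length xs" x] by metis
  let ?v = "x' @ y"
  have len: "length (t # xs @ ?v) = length (xs @ v)"
    using xby x by simp
  have "word_equiv \<Gamma> (xs @ v) (t # xs @ ?v)"
    using del x word_equiv_Cons_iff[OF t reduced_set[OF red']] by simp
  then show ?case
    using reducedI[OF red'] len word_equiv.trans[OF eq] by (intro exI[of _ ?v]) auto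
qed

text \<open>A product of commuting involutions is its own inverse, as \<open>rev xs\<close> is a
  permutation of \<open>xs\<close>.\<close>

lemma word_equiv_independent_swap:
  assumes "distinct xs" "independent_set \<Gamma> (set xs)" "set u \<subseteq> gens \<Gamma>"
  shows "word_equiv \<Gamma> (xs @ u) v \<longleftrightarrow> word_equiv \<Gamma> u (xs @ v)"
proof (cases "set v \<subseteq> gens \<Gamma>")
  case True
  have "word_equiv \<Gamma> (rev xs @ v) (xs @ v)"
    using assms True by (intro word_equiv_suffix word_equiv_indep_perm) auto
  then show ?thesis
    using word_equiv_move_left[of xs \<Gamma> u v] assms word_equiv_cong_right
    by (fastforce simp: independent_set_def)
next
  case False
  then show ?thesis using word_equiv_set(2) by fastforce
qed

text \<open>Splitting off gives a reduced word \<open>xs @ v0\<close> of \<open>w\<close>. A reduced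
  word \<open>v\<close> of \<open>T w\<close> is no longer than \<open>v0\<close>, so
  \<open>xs @ v\<close> is reduced too. Conversely, suffixes of reduced words are reduced.\<close>

lemma reduced_words_independent:
  assumes "is_coxeter_graph \<Gamma>" "reduced \<Gamma> u" "distinct xs" "independent_set \<Gamma> (set xs)"
    and "set xs \<subseteq> left_descents \<Gamma> (word_class \<Gamma> u)"
  shows "v \<in> reduced_words \<Gamma> (word_class \<Gamma> (xs @ u)) \<longleftrightarrow>
    xs @ v \<in> reduced_words \<Gamma> (word_class \<Gamma> u)"
proof -
  note swap = word_equiv_independent_swap[OF assms(3,4) reduced_set[OF assms(2)]]
  obtain v0 where v0: "reduced \<Gamma> (xs @ v0)" "word_equiv \<Gamma> u (xs @ v0)"
    using independent_descents_prefix[OF assms] by blast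
  have "reduced \<Gamma> (xs @ v)" if v: "word_equiv \<Gamma> (xs @ u) v" "reduced \<Gamma> v"
  proof -
    have "word_equiv \<Gamma> v v0"
      using v(1) v0(2) swap by (meson word_equiv.trans word_equiv.sym)
    then have "length v \<le> length v0"
      by (rule reduced_le[OF v(2)])
    moreover have "word_equiv \<Gamma> (xs @ v0) (xs @ v)"
      using v(1) v0(2) swap by (meson word_equiv.trans word_equiv.sym)
    ultimately show ?thesis using reducedI[OF v0(1)] by simp
  qed
  then show ?thesis
    using swap reduced_append_right by (auto simp: mem_reduced_words)
qed


section \<open>Commutation classes\<close>

lemma sym_commutation: "sym ((commutation_move \<Gamma>)\<^sup>*)"
proof (intro sym_rtrancl symI)
  fix u v assume "(u, v) \<in> commutation_move \<Gamma>"
  then obtain x a b y where "v = x @ [b, a] @ y" "u = x @ [a, b] @ y"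
    "b \<in> gens \<Gamma>" "a \<in> gens \<Gamma>" "b \<noteq> a" "\<not> adjacent \<Gamma> b a"
    unfolding commutation_move_def by (auto simp: adjacent_def insert_commute)
  then show "(v, u) \<in> commutation_move \<Gamma>"
    unfolding commutation_move_def by blast
qed

lemma commutation_word_equiv:
  assumes "(u, v) \<in> (commutation_move \<Gamma>)\<^sup>*" "set u \<subseteq> gens \<Gamma>"
  shows "word_equiv \<Gamma> u v \<and> length v = length u"
  using assms
proof (induction rule: rtrancl_induct)
  case base
  then show ?case by (simp add: word_equiv_refl)
next
  case (step v t)
  then obtain x a b y where v: "v = x @ [a, b] @ y" "t = x @ [b, a] @ y"
    and ab: "a \<in> gens \<Gamma>" "b \<in> gens \<Gamma>" "a \<noteq> b" "\<not> adjacent \<Gamma> a b"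
    unfolding commutation_move_def by blast
  have uv: "word_equiv \<Gamma> u v" "length v = length u"
    using step by simp_all
  have "word_equiv \<Gamma> v t"
    unfolding v using word_equiv_set(2)[OF uv(1)] v ab
    by (intro word_equiv_prefix word_equiv_suffix word_equiv_commute) auto
  then show ?case
    using uv v word_equiv.trans by fastforce
qed

lemma commutation_prefix:
  assumes "(u, v) \<in> (commutation_move \<Gamma>)\<^sup>*"
  shows "(x @ u, x @ v) \<in> (commutation_move \<Gamma>)\<^sup>*"
  using assms
proof (induction rule: rtrancl_induct)
  case (step v t)
  have "(x @ v, x @ t) \<in> commutation_move \<Gamma>"
  proof -
    obtain p a b q where "v = p @ [a, b] @ q" "t = p @ [b, a] @ q"
      and ab: "a \<in> gens \<Gamma> \<and> b \<in> gens \<Gamma> \<and> a \<noteq> b \<and> \<not> adjacent \<Gamma> a b"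
      using step(2) unfolding commutation_move_def by blast
    then have "x @ v = (x @ p) @ [a, b] @ q" "x @ t = (x @ p) @ [b, a] @ q" by simp_all
    with ab show ?thesis unfolding commutation_move_def by blast
  qed
  with step(3) show ?case by (rule rtrancl_into_rtrancl)
qed simp

text \<open>A move swaps distinct letters, so the first \<open>a\<close> remains the first
  \<open>a\<close>. Deleting it leaves either the same move or two equal words.\<close>

lemma commutation_remove1:
  assumes "(u, v) \<in> (commutation_move \<Gamma>)\<^sup>*"
  shows "(remove1 a u, remove1 a v) \<in> (commutation_move \<Gamma>)\<^sup>*"
  using assms
proof (induction rule: rtrancl_induct)
  case (step v t)
  then obtain x c d y where v: "v = x @ [c, d] @ y" "t = x @ [d, c] @ y"
    and cd: "c \<in> gens \<Gamma> \<and> d \<in> gens \<Gamma> \<and> c \<noteq> d \<and> \<not> adjacent \<Gamma> c d"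
    unfolding commutation_move_def by blast
  have swap: "(p @ [c, d] @ q, p @ [d, c] @ q) \<in> (commutation_move \<Gamma>)\<^sup>*" for p q
    using cd by (intro r_into_rtrancl) (auto simp: commutation_move_def)
  have "(remove1 a v, remove1 a t) \<in> (commutation_move \<Gamma>)\<^sup>*"
    using swap[of "remove1 a x" y] swap[of x "remove1 a y"] cd
    by (auto simp: v remove1_append)
  with step(3) show ?case by (rule rtrancl_trans)
qed simp

lemma commutation_cancel:
  assumes "(x @ u, x @ v) \<in> (commutation_move \<Gamma>)\<^sup>*"
  shows "(u, v) \<in> (commutation_move \<Gamma>)\<^sup>*"
  using assms
proof (induction x)
  case (Cons a x)
  show ?case using Cons.IH commutation_remove1[OF Cons.prems, of a] by simp
qed simp

text \<open>The condition holds for \<open>a # v\<close> and is preserved by moves: no letter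
  adjacent to \<open>a\<close> can cross the first \<open>a\<close>.\<close>

lemma commutation_initial:
  assumes "(u, a # v) \<in> (commutation_move \<Gamma>)\<^sup>*"
  shows "a \<in> set u \<and> (\<forall>b\<in>set (takeWhile (\<lambda>b. b \<noteq> a) u). \<not> adjacent \<Gamma> a b)"
  using assms
proof (induction rule: converse_rtrancl_induct)
  case (step u t)
  then obtain x c d y where "u = x @ [c, d] @ y" "t = x @ [d, c] @ y"
    "c \<noteq> d" "\<not> adjacent \<Gamma> c d"
    unfolding commutation_move_def by blast
  then show ?case
    using step(3) by (cases "a \<in> set x") (auto simp: takeWhile_append adjacent_sym split: if_splits)
qed simp

lemma commutation_to_front:
  assumes "a \<in> gens \<Gamma>" "set x \<subseteq> gens \<Gamma>" "\<forall>b\<in>set x. b \<noteq> a \<and> \<not> adjacent \<Gamma> a b"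
  shows "(x @ a # y, a # x @ y) \<in> (commutation_move \<Gamma>)\<^sup>*"
  using assms
proof (induction x)
  case (Cons b x)
  have "(b # x @ a # y, b # a # x @ y) \<in> (commutation_move \<Gamma>)\<^sup>*"
    using commutation_prefix[of "x @ a # y" "a # x @ y" \<Gamma> "[b]"] Cons by simp
  also have "(b # a # x @ y, a # b # x @ y) \<in> commutation_move \<Gamma>"
    using Cons.prems unfolding commutation_move_def
    by (intro CollectI exI[of _ "[]"] exI[of _ b] exI[of _ a] exI[of _ "x @ y"]) (auto simp: adjacent_sym)
  finally show ?case by simp
qed simp

text \<open>Letters that can each be moved to the front can be moved there together: once
  \<open>xs\<close> is in front, \<open>t\<close> commutes with everything before its first
  occurrence and can be pulled past it.\<close>

lemma commutation_prefix_of_initials: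
  assumes "\<forall>a\<in>set xs. \<exists>v. (u, a # v) \<in> (commutation_move \<Gamma>)\<^sup>*" "distinct xs" "set u \<subseteq> gens \<Gamma>"
  shows "\<exists>v. (u, xs @ v) \<in> (commutation_move \<Gamma>)\<^sup>*"
  using assms
proof (induction xs)
  case (Cons t xs)
  then obtain v where v: "(u, xs @ v) \<in> (commutation_move \<Gamma>)\<^sup>*" by auto
  obtain v' where "(u, t # v') \<in> (commutation_move \<Gamma>)\<^sup>*" using Cons.prems by auto
  then have "(xs @ v, t # v') \<in> (commutation_move \<Gamma>)\<^sup>*"
    using symD[OF sym_commutation v] by (rule rtrancl_trans[rotated])
  \<comment> \<open>As \<open>t\<close> does not occur in \<open>xs\<close>, all of
    \<open>xs\<close> stands before the first \<open>t\<close>.\<close>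
  moreover have "takeWhile (\<lambda>b. b \<noteq> t) (xs @ v) = xs @ takeWhile (\<lambda>b. b \<noteq> t) v"
    using Cons.prems(2) by (intro takeWhile_append2) auto
  ultimately have t: "t \<in> set v" "\<forall>b\<in>set xs \<union> set (takeWhile (\<lambda>b. b \<noteq> t) v). \<not> adjacent \<Gamma> t b"
    using Cons.prems(2) commutation_initial[of "xs @ v" t v' \<Gamma>] by auto
  obtain x y where vxy: "v = x @ t # y" and "t \<notin> set x"
    using split_list_first[OF t(1)] by blast
  then have x: "\<forall>b\<in>set x. \<not> adjacent \<Gamma> t b"
    using t(2) by (auto simp: takeWhile_append)
  have "set (xs @ v) \<subseteq> gens \<Gamma>"
    using commutation_word_equiv[OF v Cons.prems(3)] word_equiv_set(2) by blast
  then have "((xs @ x) @ t # y, t # (xs @ x) @ y) \<in> (commutation_move \<Gamma>)\<^sup>*"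
    using t(2) x \<open>t \<notin> set x\<close> Cons.prems(2) unfolding vxy
    by (intro commutation_to_front) auto
  then show ?case
    using rtrancl_trans[OF v, of "t # xs @ x @ y"] unfolding vxy by auto
qed auto

section \<open>Commutation classes of a group element and their first letters\<close>

lemma commutation_class_eq_iff:
  "(commutation_move \<Gamma>)\<^sup>* `` {u} = (commutation_move \<Gamma>)\<^sup>* `` {v} \<longleftrightarrow> (u, v) \<in> (commutation_move \<Gamma>)\<^sup>*"
  using sym_commutation[of \<Gamma>] by (auto simp: set_eq_iff dest: symD intro: rtrancl_trans)

lemma reduced_words_commutation_closed:
  assumes "(v, t) \<in> (commutation_move \<Gamma>)\<^sup>*" "v \<in> reduced_words \<Gamma> (word_class \<Gamma> u)"
  shows "t \<in> reduced_words \<Gamma> (word_class \<Gamma> u)"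
proof -
  have v: "word_equiv \<Gamma> u v" "reduced \<Gamma> v" using assms(2) by (simp_all add: mem_reduced_words)
  have "word_equiv \<Gamma> v t" "length t = length v"
    using commutation_word_equiv[OF assms(1) reduced_set[OF v(2)]] by simp_all
  then show ?thesis
    using v reducedI word_equiv.trans by (fastforce simp: mem_reduced_words)
qed

text \<open>Reduced words of an element are closed under moves, so its classes are full classes of
  one relation on words, the same for all elements.\<close>

lemma commutation_classes_word_class:
  "commutation_classes \<Gamma> (word_class \<Gamma> u) =
    (\<lambda>v. (commutation_move \<Gamma>)\<^sup>* `` {v}) ` reduced_words \<Gamma> (word_class \<Gamma> u)"
proof -
  let ?R = "reduced_words \<Gamma> (word_class \<Gamma> u)"
  have "((commutation_move \<Gamma>)\<^sup>* \<inter> ?R \<times> ?R) `` {v} = (commutation_move \<Gamma>)\<^sup>* `` {v}" if "v \<in> ?R" for v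
    using that reduced_words_commutation_closed by blast
  then show ?thesis
    unfolding commutation_classes_def quotient_def by auto
qed

definition initial_letters :: "'a list set \<Rightarrow> 'a set" where
  "initial_letters c = {a. \<exists>v. a # v \<in> c}"

text \<open>Both images are in bijection with the quotient of \<open>A\<close> by the common kernel
  of \<open>f\<close> and \<open>g\<close>.\<close>

lemma card_image_eq_card_image:
  assumes "\<And>x y. x \<in> A \<Longrightarrow> y \<in> A \<Longrightarrow> f x = f y \<longleftrightarrow> g x = g y"
  shows "card (f ` A) = card (g ` A)"
proof (rule bij_betw_same_card)
  have inv: "inv_into A f (f x) \<in> A \<and> f (inv_into A f (f x)) = f x" if "x \<in> A" for x
    using that by (simp add: inv_into_into f_inv_into_f)
  have g: "g (inv_into A f (f x)) = g x" if "x \<in> A" for x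
    using inv[OF that] assms that by blast
  show "bij_betw (\<lambda>z. g (inv_into A f z)) (f ` A) (g ` A)"
    using g assms by (auto simp: bij_betw_def inj_on_def image_image)
qed

text \<open>Prefixing \<open>xs\<close> respects classes and is injective on them by left
  cancellation. In \<open>xs @ v\<close> each letter of \<open>xs\<close> can be pulled to the
  front; conversely, letters that are all initial in a class can be brought to the front as the
  block \<open>xs\<close>.\<close>

lemma num_commutation_classes_independent:
  assumes "is_coxeter_graph \<Gamma>" "reduced \<Gamma> u" "distinct xs" "independent_set \<Gamma> (set xs)"
    and "set xs \<subseteq> left_descents \<Gamma> (word_class \<Gamma> u)"
  shows "num_commutation_classes \<Gamma> (word_class \<Gamma> (xs @ u)) =
    card {c \<in> commutation_classes \<Gamma> (word_class \<Gamma> u). set xs \<subseteq> initial_letters c}"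
proof -
  let ?M = "(commutation_move \<Gamma>)\<^sup>*"
  let ?R = "reduced_words \<Gamma> (word_class \<Gamma> u)" and ?R' = "reduced_words \<Gamma> (word_class \<Gamma> (xs @ u))"
  note mem = reduced_words_independent[OF assms]
  have "num_commutation_classes \<Gamma> (word_class \<Gamma> (xs @ u)) = card ((\<lambda>v. ?M `` {v}) ` ?R')"
    by (simp add: num_commutation_classes_def commutation_classes_word_class)
  also have "\<dots> = card ((\<lambda>v. ?M `` {xs @ v}) ` ?R')"
    by (rule card_image_eq_card_image, unfold commutation_class_eq_iff)
      (blast intro: commutation_prefix commutation_cancel)
  also have "(\<lambda>v. ?M `` {xs @ v}) ` ?R' =
      {c \<in> commutation_classes \<Gamma> (word_class \<Gamma> u). set xs \<subseteq> initial_letters c}"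
  proof (intro equalityI subsetI)
    fix c assume "c \<in> (\<lambda>v. ?M `` {xs @ v}) ` ?R'"
    then obtain v where v: "xs @ v \<in> ?R" and c: "c = ?M `` {xs @ v}" using mem by blast
    have "a \<in> initial_letters c" if a: "a \<in> set xs" for a
    proof -
      obtain p q where xs: "xs = p @ a # q" using split_list[OF a] by blast
      have "(p @ a # (q @ v), a # p @ (q @ v)) \<in> ?M"
        using assms(3,4) unfolding xs
        by (intro commutation_to_front) (auto simp: independent_set_def)
      then show ?thesis by (auto simp: initial_letters_def c xs)
    qed
    then show "c \<in> {c \<in> commutation_classes \<Gamma> (word_class \<Gamma> u). set xs \<subseteq> initial_letters c}"
      using v c by (auto simp: commutation_classes_word_class)
  next
    fix c assume c: "c \<in> {c \<in> commutation_classes \<Gamma> (word_class \<Gamma> u). set xs \<subseteq> initial_letters c}"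
    then obtain t where t: "t \<in> ?R" "c = ?M `` {t}" by (auto simp: commutation_classes_word_class)
    have "set t \<subseteq> gens \<Gamma>" using t(1) reduced_set by (auto simp: mem_reduced_words)
    then obtain v where v: "(t, xs @ v) \<in> ?M"
      using commutation_prefix_of_initials[of xs t \<Gamma>] c t(2) assms(3)
      by (auto simp: initial_letters_def)
    then have "c = ?M `` {xs @ v}" using t(2) commutation_class_eq_iff by blast
    moreover have "v \<in> ?R'"
      using reduced_words_commutation_closed[OF v t(1)] mem by blast
    ultimately show "c \<in> (\<lambda>v. ?M `` {xs @ v}) ` ?R'" by blast
  qed
  finally show ?thesis .
qed

text \<open>If \<open>a # v\<close> and \<open>b # v'\<close> lie in one class with
  \<open>a \<noteq> b\<close>, then \<open>b\<close> stands before the first \<open>a\<close> in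
  \<open>b # v'\<close>, so by \<open>commutation_initial\<close> it is not adjacent to
  \<open>a\<close>.\<close>

lemma initial_letters_independent_descents:
  assumes "reduced \<Gamma> u" "c \<in> commutation_classes \<Gamma> (word_class \<Gamma> u)"
  shows "initial_letters c \<subseteq> left_descents \<Gamma> (word_class \<Gamma> u)"
    and "independent_set \<Gamma> (initial_letters c)"
proof -
  let ?M = "(commutation_move \<Gamma>)\<^sup>*"
  obtain t where t: "t \<in> reduced_words \<Gamma> (word_class \<Gamma> u)" "c = ?M `` {t}"
    using assms(2) by (auto simp: commutation_classes_word_class)
  have c: "c \<subseteq> reduced_words \<Gamma> (word_class \<Gamma> u)"
    using t reduced_words_commutation_closed by blast
  then show D: "initial_letters c \<subseteq> left_descents \<Gamma> (word_class \<Gamma> u)"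
    using mem_left_descents[OF assms(1)]
    by (fastforce simp: initial_letters_def mem_reduced_words)
  have "\<not> adjacent \<Gamma> a b" if ab: "a \<in> initial_letters c" "b \<in> initial_letters c" "a \<noteq> b" for a b
  proof -
    obtain v v' where "(t, a # v) \<in> ?M" "(t, b # v') \<in> ?M"
      using ab t(2) by (auto simp: initial_letters_def)
    then have "(b # v', a # v) \<in> ?M"
      by (meson sym_commutation symD rtrancl_trans)
    from commutation_initial[OF this] \<open>a \<noteq> b\<close> show ?thesis by simp
  qed
  moreover have "initial_letters c \<subseteq> gens \<Gamma>"
    using D by (auto simp: left_descents_def)
  ultimately show "independent_set \<Gamma> (initial_letters c)"
    by (simp add: independent_set_def)
qed

text \<open>Since the element is not 1, its reduced words are not empty and have a first
  letter.\<close>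

lemma initial_letters_nonempty:
  assumes "word_class \<Gamma> u \<noteq> \<one>\<^bsub>coxeter_group \<Gamma>\<^esub>" "c \<in> commutation_classes \<Gamma> (word_class \<Gamma> u)"
  shows "initial_letters c \<noteq> {}"
proof -
  obtain t where t: "t \<in> reduced_words \<Gamma> (word_class \<Gamma> u)" "c = (commutation_move \<Gamma>)\<^sup>* `` {t}"
    using assms(2) by (auto simp: commutation_classes_word_class)
  have "t \<noteq> []"
    using t(1) assms(1) word_class_eqI[of \<Gamma> u t] by (auto simp: mem_reduced_words one_coxeter_group)
  then show ?thesis
    using t(2) by (cases t) (auto simp: initial_letters_def)
qed

section \<open>Inclusion-exclusion over the descents\<close>

theorem theorem2p2:
  fixes \<Gamma> :: "'a coxeter_graph" and w :: "'a list set"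
  assumes "is_coxeter_graph \<Gamma>"
    and "w \<in> carrier (coxeter_group \<Gamma>)"
    and "w \<noteq> \<one>\<^bsub>coxeter_group \<Gamma>\<^esub>"
  shows "int (num_commutation_classes \<Gamma> w) =
    (\<Sum>T | T \<noteq> {} \<and> T \<subseteq> left_descents \<Gamma> w \<and> independent_set \<Gamma> T.
       (- 1) ^ (card T + 1) * int (num_commutation_classes \<Gamma> (set_product \<Gamma> T \<otimes>\<^bsub>coxeter_group \<Gamma>\<^esub> w)))"
proof -
  obtain s where s: "w = word_class \<Gamma> s" "set s \<subseteq> gens \<Gamma>"
    using assms(2) unfolding carrier_coxeter_group by auto
  then obtain u where u: "reduced \<Gamma> u" "word_equiv \<Gamma> s u"
    using ex_reduced by metis
  have w: "w = word_class \<Gamma> u"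
    using s(1) word_class_eqI[OF u(2)] by simp
  define D where "D = left_descents \<Gamma> w"
  define K where "K = commutation_classes \<Gamma> w"
  define G where "G a = {c \<in> K. a \<in> initial_letters c}" for a
  have finD: "finite D"
    unfolding D_def w by (rule finite_left_descents[OF assms(1) u(1)])
  have finK: "finite K"
    unfolding K_def w commutation_classes_word_class
    by (intro finite_imageI finite_reduced_words[OF assms(1) u(1)])
  have letters: "initial_letters c \<subseteq> D" "independent_set \<Gamma> (initial_letters c)"
    "initial_letters c \<noteq> {}" if "c \<in> K" for c
    using that initial_letters_independent_descents[OF u(1)] initial_letters_nonempty[of \<Gamma> u]
      assms(3) unfolding D_def K_def w by blast+
  have G_Inter: "\<Inter> (G ` T) = {c \<in> K. T \<subseteq> initial_letters c}" if "T \<noteq> {}" for T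
    using that by (auto simp: G_def)
  have num: "num_commutation_classes \<Gamma> (set_product \<Gamma> T \<otimes>\<^bsub>coxeter_group \<Gamma>\<^esub> w) = card (\<Inter> (G ` T))"
    if T: "T \<noteq> {}" "T \<subseteq> D" "independent_set \<Gamma> T" for T
  proof -
    obtain xs where xs: "distinct xs" "set xs = T"
      using finite_distinct_list[OF finite_subset[OF T(2) finD]] by blast
    have "set_product \<Gamma> T \<otimes>\<^bsub>coxeter_group \<Gamma>\<^esub> w = word_class \<Gamma> (xs @ u)"
      using set_product_eq[OF T(3) xs] T(3) xs(2) reduced_set[OF u(1)]
      by (simp add: w mult_word_class independent_set_def)
    then show ?thesis
      using num_commutation_classes_independent[OF assms(1) u(1) xs(1)] T xs(2)
      by (simp add: G_Inter K_def D_def w)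
  qed
  \<comment> \<open>Initial letters form an independent set, so a dependent \<open>T\<close> is
    contained in none; this later restricts the sum to independent sets.\<close>
  have zero: "\<Inter> (G ` T) = {}" if "T \<noteq> {}" "\<not> independent_set \<Gamma> T" for T
  proof -
    have False if "c \<in> K" "T \<subseteq> initial_letters c" for c
      using letters(2)[OF that(1)] that(2) \<open>\<not> independent_set \<Gamma> T\<close>
      unfolding independent_set_def by blast
    then show ?thesis using G_Inter[OF \<open>T \<noteq> {}\<close>] by blast
  qed
  interpret Incl_Excl finite "\<lambda>A. int (card A)"
    by unfold_locales (auto simp: card_Un_disjoint disjnt_def)
  \<comment> \<open>The sets \<open>G a\<close> cover \<open>K\<close>, because every class has an
    initial letter and it is a descent.\<close>
  have "int (card K) = int (card (\<Union> (G ` D)))"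
    using letters by (intro arg_cong[where f = "\<lambda>A. int (card A)"]) (fastforce simp: G_def)
  also have "\<dots> = (\<Sum>T | T \<subseteq> D \<and> T \<noteq> {}. (- 1) ^ (card T + 1) * int (card (\<Inter> (G ` T))))"
    using finD finK by (intro restricted_indexed) (auto simp: G_def)
  also have "\<dots> = (\<Sum>T | T \<noteq> {} \<and> T \<subseteq> D \<and> independent_set \<Gamma> T.
      (- 1) ^ (card T + 1) * int (card (\<Inter> (G ` T))))"
  proof (intro sum.mono_neutral_right ballI)
    fix T assume "T \<in> {T. T \<subseteq> D \<and> T \<noteq> {}} - {T. T \<noteq> {} \<and> T \<subseteq> D \<and> independent_set \<Gamma> T}"
    then have "\<Inter> (G ` T) = {}" by (intro zero) auto
    then show "(- 1) ^ (card T + 1) * int (card (\<Inter> (G ` T))) = 0" by simp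
  qed (use finD in auto)
  also have "\<dots> = (\<Sum>T | T \<noteq> {} \<and> T \<subseteq> D \<and> independent_set \<Gamma> T.
      (- 1) ^ (card T + 1) *
        int (num_commutation_classes \<Gamma> (set_product \<Gamma> T \<otimes>\<^bsub>coxeter_group \<Gamma>\<^esub> w)))"
    using num by (intro sum.cong) auto
  finally show ?thesis
    by (simp add: num_commutation_classes_def K_def D_def)
qed

end
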